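(* Let $\Omega=[0,1]^n$, $\mathbb{D}=\mathbb{R}^n$, let $\emptyset\ne\Lambda'\subseteq\mathbb{R}^n$ be unbounded, $c\in\mathbb{C}\setminus\{0\}$, $p,q\in\mathcal{P}(\Omega)$, and let $\mathsf{F},\mathsf{F}_1:\mathbb{R}^n\times(0,\infty)\times\Lambda'\to(0,\infty)$, resp. $\mathbf{F},\mathbf{F}_1:\mathbb{R}^n\times\mathbb{N}\to(0,\infty)$. Let a function $F:\mathbb{R}^n\times X\to Y$ be Stepanov-$[\Omega,\mathcal{B},\Lambda',\mathbb{D},p,\phi,\mathsf{F},c]$-quasi-asymptotically almost periodic, resp. Stepanov-$[\Omega,\mathcal{B},\Lambda',\mathbb{D},p,\phi,\mathbf{F},c]$-quasi-asymptotically uniformly recurrent, where $\phi:[0,\infty)\to[0,\infty)$ is a convex, monotonically increasing function for which there exists a function $\varphi:[0,\infty)\to[0,\infty)$ such that $\phi(xy)\le\varphi(x)\phi(y)$ for all $x,y\ge0$. Let $h\in L^1(\mathbb{R}^n)$ and suppose that $\sup_{\mathbf{t}\in\mathbb{R}^n;x\in B}\|F(\mathbf{t};x)\|_Y<\infty$ for each set $B\in\mathcal{B}$. Suppose that there exist a continuous function $g:[0,\infty)\to[0,\infty)$ with $g(0+)=0+$ and a family $(a_k)_{k\in\mathbb{Z}^n}$ of strictly positive reals such that $\sum_{k\in\mathbb{Z}^n}a_k=1$ and such that for each $\epsilon>0$ and $\tau\in\Lambda'$, resp. for each $m\in\mathbb{N}$ and $\tau\in\Lambda'$, there exists $M'(\epsilon,\tau)>0$,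 resp. $M'(m,\tau)>0$, such that for each $\mathbf{t}\in\mathbb{R}^n$ with $|\mathbf{t}|\ge M'(\epsilon,\tau)$, resp. $|\mathbf{t}|\ge M'(m,\tau)$, we have $$\int_{[0,1]^n}\varphi_{p(\mathbf{u})}\Biggl(\mathsf{F}_1(\mathbf{t},\epsilon,\tau)\Biggl(\varphi(2)\sum_{k\in\mathbb{Z}^n}\frac{a_k\,\varphi(a_k^{-1})\,\bigl\|\varphi(|h(\mathbf{t}-\sigma-k)|)\bigr\|_{L^{q(\sigma)}(\Omega)}}{\mathsf{F}(\mathbf{u}+k,\epsilon,\tau)}+g(\epsilon)\Biggr)\Biggr)\,d\mathbf{u}\le1,$$ resp. $$\int_{[0,1]^n}\varphi_{p(\mathbf{u})}\Biggl(\mathbf{F}_1(\mathbf{t},m)\Biggl(\varphi(2)\sum_{k\in\mathbb{Z}^n}\frac{a_k\,\varphi(a_k^{-1})\,\bigl\|\varphi(|h(\mathbf{t}-\sigma-k)|)\bigr\|_{L^{q(\sigma)}(\Omega)}}{\mathbf{F}(\mathbf{u}+k,m)}+g(1/m)\Biggr)\Biggr)\,d\mathbf{u}\le1,$$ where the $L^{q(\sigma)}(\Omega)$-norm is taken in the variable $\sigma\in\Omega$. Then the function $(h\ast F)(\mathbf{t};x):=\int_{\mathbb{R}^n}h(\sigma)F(\mathbf{t}-\sigma;x)\,d\sigma$ is Stepanov-$[\Omega,\mathcal{B},\Lambda',\mathbb{D},p,\phi,\mathsf{F}_1,c]$-quasi-asymptotically almost periodic, resp. Stepanov-$[\Omega,\mathcal{B},\Lambda',\mathbb{D},p,\phi,\mathbf{F}_1,c]$-quasi-asymptotically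 uniformly recurrent.
   Context: $X,Y$ are complex Banach spaces. $\mathcal{B}$ is a collection of non-empty subsets of $X$ such that every $x\in X$ belongs to some $B\in\mathcal{B}$. $B(\mathbf{t}_0,l)$ is the closed Euclidean ball in $\mathbb{R}^n$. The condition $g(0+)=0+$ means that $g(s)\to0+$ as $s\to0+$. Variable exponent spaces: $\mathcal{P}(\Omega)$ is the set of Lebesgue measurable functions $p:\Omega\to[1,\infty]$. For $p\in\mathcal{P}(\Omega)$ put $\varphi_{p(x)}(t)=t^{p(x)}$ for $t\ge0$ if $p(x)<\infty$; if $p(x)=\infty$, put $\varphi_{p(x)}(t)=0$ for $0\le t\le1$ and $\varphi_{p(x)}(t)=\infty$ for $t>1$. (The functions $\varphi_{p(x)}$ are not to be confused with the function $\varphi$ in the claim.) For measurable $f$ on $\Omega$ set $\rho(f)=\int_\Omega\varphi_{p(x)}(|f(x)|)\,dx$; $L^{p(x)}(\Omega)$ consists of those $f$ with $\rho(\lambda f)<\infty$ for some $\lambda>0$, with the Luxemburg norm $\|f\|_{L^{p(x)}(\Omega)}=\inf\{\lambda>0:\rho(f/\lambda)\le1\}$. $F:\mathbb{R}^n\times X\to Y$ is Stepanov-$[\Omega,\mathcal{B},\Lambda',\mathbb{R}^n,p,\phi,\mathsf{F},c]$-quasi-asymptotically almost periodic if for every $B\in\mathcal{B}$ and $\epsilon>0$ there exists $l>0$ such that for each $\mathbf{t}_0\in\Lambda'$ there exist $\tau\in B(\mathbf{t}_0,l)\cap\Lambda'$ and a finite real number $M(\epsilon,\tau)>0$ such that $$\sup_{|\mathbf{t}|\ge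 M(\epsilon,\tau),\,|\mathbf{t}+\tau|\ge M(\epsilon,\tau);\,x\in B}\mathsf{F}(\mathbf{t},\epsilon,\tau)\,\Bigl\|\phi\bigl(\|F(\cdot+\mathbf{t}+\tau;x)-cF(\cdot+\mathbf{t};x)\|_Y\bigr)\Bigr\|_{L^{p(\cdot)}(\Omega)}\le\epsilon.$$ $F$ is Stepanov-$[\Omega,\mathcal{B},\Lambda',\mathbb{R}^n,p,\phi,\mathbf{F},c]$-quasi-asymptotically uniformly recurrent if for every $B\in\mathcal{B}$ there exist a sequence $(\tau_k)$ in $\Lambda'$ whose norms are strictly increasing and tend to $+\infty$, and a sequence $(M_k)$ of positive reals tending to $+\infty$, such that $$\lim_{k\to+\infty}\sup_{|\mathbf{t}|\ge M_k,\,|\mathbf{t}+\tau_k|\ge M_k;\,x\in B}\mathbf{F}(\mathbf{t},k)\,\Bigl\|\phi\bigl(\|F(\cdot+\mathbf{t}+\tau_k;x)-cF(\cdot+\mathbf{t};x)\|_Y\bigr)\Bigr\|_{L^{p(\cdot)}(\Omega)}=0.$$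
   Formalization: The formal theorem also assumes 1/p(u)+1/q(u)=1 for a.e. u in Ω and, in the almost periodic part, g(s)>0 for all s>0 (the claim fails without these); "monotonically increasing" is read as strictly increasing, and the integral defining h∗F is assumed to exist. *)

theory Defs
  imports "HOL-Analysis.Analysis"
begin

class complex_banach = banach +
  fixes scaleC :: "complex \<Rightarrow> 'a \<Rightarrow> 'a"  (infixr \<open>*\<^sub>C\<close> 75)
  assumes scaleC_add_right: "a *\<^sub>C (x + y) = a *\<^sub>C x + a *\<^sub>C y"
    and scaleC_add_left: "(a + b) *\<^sub>C x = a *\<^sub>C x + b *\<^sub>C x"
    and scaleC_scaleC: "a *\<^sub>C b *\<^sub>C x = (a * b) *\<^sub>C x"
    and scaleR_eq_scaleC: "r *\<^sub>R x = complex_of_real r *\<^sub>C x"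
    and norm_scaleC: "norm (a *\<^sub>C x) = cmod a * norm x"

instantiation complex :: complex_banach
begin

definition "a *\<^sub>C (x :: complex) = a * x"

instance
  by standard (simp_all add: scaleC_complex_def algebra_simps scaleR_conv_of_real norm_mult)

end

text \<open>The library's Bochner integral is restricted to second countable range types. The next
  predicate is its definition with that sort constraint dropped, so that it covers arbitrary Banach
  spaces: a subsequence of the simple functions converges almost everywhere to the function, which
  is therefore strongly measurable. The integral is only meaningful if it exists.\<close>

definition has_bochner :: "'a measure \<Rightarrow> ('a \<Rightarrow> 'b::real_normed_vector) \<Rightarrow> 'b \<Rightarrow> bool" where
  "has_bochner M f I \<longleftrightarrow> f \<in> borel_measurable M \<and>
     (\<exists>s. (\<forall>i::nat. Bochner_Integration.simple_bochner_integrable M (s i)) \<and>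
          (\<lambda>i. \<integral>\<^sup>+x. norm (f x - s i x) \<partial>M) \<longlonglongrightarrow> 0 \<and>
          (\<lambda>i. Bochner_Integration.simple_bochner_integral M (s i)) \<longlonglongrightarrow> I)"

lemma has_bochner_eq_has_bochner_integral:
  fixes f :: "'a \<Rightarrow> 'b::{real_normed_vector, second_countable_topology}"
  shows "has_bochner M f I \<longleftrightarrow> has_bochner_integral M f I"
  unfolding has_bochner_def has_bochner_integral.simps by auto

definition bochner_integrable :: "'a measure \<Rightarrow> ('a \<Rightarrow> 'b::real_normed_vector) \<Rightarrow> bool" where
  "bochner_integrable M f \<longleftrightarrow> (\<exists>I. has_bochner M f I)"

definition bochner_integral :: "'a measure \<Rightarrow> ('a \<Rightarrow> 'b::real_normed_vector) \<Rightarrow> 'b" where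
  "bochner_integral M f = (THE I. has_bochner M f I)"

definition var_exponents :: "'a::euclidean_space set \<Rightarrow> ('a \<Rightarrow> ennreal) set" where
  "var_exponents \<Omega> = {p \<in> borel_measurable (lebesgue_on \<Omega>). \<forall>u\<in>\<Omega>. 1 \<le> p u}"

text \<open>The function \<open>t \<mapsto> t\<^sup>r\<close>, with its limit \<open>\<infinity>\<close> as value at \<open>t = \<infinity>\<close>
  (the argument can be an infinite sum).\<close>

definition phi_pow :: "ennreal \<Rightarrow> ennreal \<Rightarrow> ennreal" where
  "phi_pow r t = (if r = \<infinity> then (if t \<le> 1 then 0 else \<infinity>)
                  else if t = \<infinity> then \<infinity> else ennreal (enn2real t powr enn2real r))"

definition var_modular ::
  "'a::euclidean_space set \<Rightarrow> ('a \<Rightarrow> ennreal) \<Rightarrow> ('a \<Rightarrow> real) \<Rightarrow> ennreal" where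
  "var_modular \<Omega> p f = (\<integral>\<^sup>+u. phi_pow (p u) (ennreal \<bar>f u\<bar>) \<partial>lebesgue_on \<Omega>)"

definition var_Lp :: "'a::euclidean_space set \<Rightarrow> ('a \<Rightarrow> ennreal) \<Rightarrow> ('a \<Rightarrow> real) set" where
  "var_Lp \<Omega> p = {f \<in> borel_measurable (lebesgue_on \<Omega>).
                  \<exists>r>0. var_modular \<Omega> p (\<lambda>u. r * f u) < \<infinity>}"

text \<open>The Luxemburg norm, with value \<open>\<infinity>\<close> for functions outside the space (in particular
  for non-measurable ones), so that finiteness of a norm includes membership in the space.\<close>

definition lux_norm ::
  "'a::euclidean_space set \<Rightarrow> ('a \<Rightarrow> ennreal) \<Rightarrow> ('a \<Rightarrow> real) \<Rightarrow> ennreal" where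
  "lux_norm \<Omega> p f =
     (if f \<in> var_Lp \<Omega> p
      then Inf (ennreal ` {r. 0 < r \<and> var_modular \<Omega> p (\<lambda>u. f u / r) \<le> 1}) else \<infinity>)"

definition stepanov_diff ::
  "(real^'n) set \<Rightarrow> (real^'n \<Rightarrow> ennreal) \<Rightarrow> (real \<Rightarrow> real) \<Rightarrow> complex
    \<Rightarrow> (real^'n \<Rightarrow> 'x \<Rightarrow> 'y::complex_banach) \<Rightarrow> real^'n \<Rightarrow> real^'n \<Rightarrow> 'x \<Rightarrow> ennreal" where
  "stepanov_diff \<Omega> p \<phi> c F \<tau> t x =
     lux_norm \<Omega> p (\<lambda>u. \<phi> (norm (F (u + t + \<tau>) x - c *\<^sub>C F (u + t) x)))"

text \<open>The suprema below are taken in \<open>[0, \<infinity>]\<close>. The domain called \<open>\<bbbD>\<close> in the literature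
  is the whole space here.\<close>

definition stepanov_quasi_aap ::
  "(real^'n) set \<Rightarrow> 'x set set \<Rightarrow> (real^'n) set \<Rightarrow> (real^'n \<Rightarrow> ennreal) \<Rightarrow> (real \<Rightarrow> real)
    \<Rightarrow> (real^'n \<Rightarrow> real \<Rightarrow> real^'n \<Rightarrow> real) \<Rightarrow> complex
    \<Rightarrow> (real^'n \<Rightarrow> 'x \<Rightarrow> 'y::complex_banach) \<Rightarrow> bool" where
  "stepanov_quasi_aap \<Omega> \<B> \<Lambda>' p \<phi> W c F \<longleftrightarrow>
     (\<forall>B\<in>\<B>. \<forall>\<epsilon>>0. \<exists>l>0. \<forall>t0\<in>\<Lambda>'. \<exists>\<tau>\<in>cball t0 l \<inter> \<Lambda>'. \<exists>M>0.
        (SUP (t, x) \<in> {(t, x). M \<le> norm t \<and> M \<le> norm (t + \<tau>) \<and> x \<in> B}.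
           ennreal (W t \<epsilon> \<tau>) * stepanov_diff \<Omega> p \<phi> c F \<tau> t x) \<le> ennreal \<epsilon>)"

text \<open>Sequences are indexed by the positive integers; their values at 0 are irrelevant.\<close>

definition stepanov_quasi_aur ::
  "(real^'n) set \<Rightarrow> 'x set set \<Rightarrow> (real^'n) set \<Rightarrow> (real^'n \<Rightarrow> ennreal) \<Rightarrow> (real \<Rightarrow> real)
    \<Rightarrow> (real^'n \<Rightarrow> nat \<Rightarrow> real) \<Rightarrow> complex
    \<Rightarrow> (real^'n \<Rightarrow> 'x \<Rightarrow> 'y::complex_banach) \<Rightarrow> bool" where
  "stepanov_quasi_aur \<Omega> \<B> \<Lambda>' p \<phi> W c F \<longleftrightarrow>
     (\<forall>B\<in>\<B>. \<exists>(\<tau> :: nat \<Rightarrow> real^'n) (M :: nat \<Rightarrow> real).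
        (\<forall>k\<ge>1. \<tau> k \<in> \<Lambda>') \<and> strict_mono_on {1..} (\<lambda>k. norm (\<tau> k)) \<and>
        filterlim (\<lambda>k. norm (\<tau> k)) at_top sequentially \<and>
        (\<forall>k\<ge>1. 0 < M k) \<and> filterlim M at_top sequentially \<and>
        (\<lambda>k. SUP (t, x) \<in> {(t, x). M k \<le> norm t \<and> M k \<le> norm (t + \<tau> k) \<and> x \<in> B}.
               ennreal (W t k) * stepanov_diff \<Omega> p \<phi> c F (\<tau> k) t x) \<longlonglongrightarrow> 0)"

definition conv ::
  "(real^'n \<Rightarrow> complex) \<Rightarrow> (real^'n \<Rightarrow> 'x \<Rightarrow> 'y::complex_banach) \<Rightarrow> real^'n \<Rightarrow> 'x \<Rightarrow> 'y" where
  "conv h F t x = bochner_integral lebesgue (\<lambda>\<sigma>. h \<sigma> *\<^sub>C F (t - \<sigma>) x)"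

definition lattice_pt :: "int^'n \<Rightarrow> real^'n" where
  "lattice_pt k = (\<chi> i. real_of_int (k $ i))"

text \<open>The modular, over \<open>u \<in> \<Omega>\<close>, of
  \<open>v * (\<psi>(2) * (\<Sum>\<^sub>k a\<^sub>k \<psi>(1/a\<^sub>k) \<parallel>\<psi>(\<bar>h(t - \<cdot> - k)\<bar>)\<parallel> / w(u + k)) + \<gamma>)\<close>,
  where the norm is that of \<open>L\<^sup>q(\<Omega>)\<close> and \<open>w\<close>, \<open>v\<close>, \<open>\<gamma>\<close> stand for the weights and the value
  of \<open>g\<close> at fixed parameters. The argument can be infinite, hence no use of the modular above.\<close>

definition kernel_modular ::
  "(real^'n) set \<Rightarrow> (real^'n \<Rightarrow> ennreal) \<Rightarrow> (real^'n \<Rightarrow> ennreal) \<Rightarrow> (real \<Rightarrow> real)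
    \<Rightarrow> (int^'n \<Rightarrow> real) \<Rightarrow> (real^'n \<Rightarrow> complex) \<Rightarrow> (real^'n \<Rightarrow> real) \<Rightarrow> real \<Rightarrow> real
    \<Rightarrow> real^'n \<Rightarrow> ennreal" where
  "kernel_modular \<Omega> p q \<psi> a h w v \<gamma> t =
     (\<integral>\<^sup>+u. phi_pow (p u)
        (ennreal v *
          (ennreal (\<psi> 2) *
             (\<Sum>\<^sub>\<infinity>k\<in>UNIV. ennreal (a k * \<psi> (inverse (a k))) *
                lux_norm \<Omega> q (\<lambda>\<sigma>. \<psi> (cmod (h (t - \<sigma> - lattice_pt k))))
                / ennreal (w (u + lattice_pt k)))
           + ennreal \<gamma>)) \<partial>lebesgue_on \<Omega>)"

end

theory Submission
  imports Defs
begin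

text \<open>
  With \<open>D s = \<parallel>F (s + \<tau>) - c F s\<parallel>\<close> the difference of the convolution at \<open>u + t\<close> is at most
  \<open>\<integral> \<bar>h (t - s)\<bar> D (u + s) ds\<close>. Cut the integral into the cells \<open>k + [0,1)\<^sup>n\<close> of the integer
  lattice and call a cell near if \<open>\<bar>u + k\<bar> < M\<close> or \<open>\<bar>u + k + \<tau>\<bar> < M\<close>. The near cells lie in a fixed
  ball; since \<open>F\<close> is bounded and \<open>h\<close> integrable, their contribution tends to 0 as \<open>\<bar>t\<bar> \<rightarrow> \<infinity>\<close>,
  uniformly in \<open>u \<in> \<Omega>\<close>, and is absorbed by \<open>g\<close>. For the far cells, Jensen's inequality with
  the weights \<open>a\<^sub>k\<close>, the submultiplicativity of \<open>\<phi>\<close> and Hoelder's inequality (with constant 2) bound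
  \<open>\<phi>\<close> of the contribution by twice the kernel sum. The two parts are joined by convexity and
  \<open>\<phi> (2 y) \<le> \<psi> 2 * \<phi> y\<close>, and the modular is monotone. Measurability of the new difference follows
  from continuity of \<open>h * F\<close>, that is, from continuity of translations in \<open>L\<^sup>1\<close>. If \<open>\<phi> 0 > 0\<close>, the
  kernel sum is infinite.
\<close>

section \<open>Bochner integrals in non-separable spaces\<close>

text \<open>The cells partition the integration variable \<open>s\<close> and do not move with
  \<open>u\<close>. For \<open>s = k + \<sigma>\<close> one has
  \<open>u + s = \<sigma> + (u + k)\<close>, so cell \<open>k\<close> sees exactly the Stepanov norm
  of \<open>F\<close> based at \<open>u + k\<close>. This is why near and far are decided at
  \<open>u + k\<close> and why the weight in the kernel sum is \<open>w (u + k)\<close>. The factor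
  \<open>h (t - s)\<close> is free of \<open>u\<close>, which makes the bound on the near part
  uniform in \<open>u\<close>. Since \<open>\<tau>\<close> and \<open>M\<close> are fixed before
  \<open>t\<close> grows, so is the ball that holds the near cells. The constants balance: the 1/2
  from convexity cancels the 2 from Hoelder's inequality, and only \<open>\<psi> 2\<close> remains
  in front of the kernel sum. The values of \<open>F\<close> may span a non-separable space, where a
  difference of Borel functions can fail to be Borel. Vector-valued integrals therefore enter
  through a single inequality, the norm of \<open>I - c J\<close> against the integral of the norm
  of \<open>f - c g\<close>; uniqueness of the integral, continuity of the convolution and the bound
  on its difference are all instances of it.\<close>

text \<open>On each of the finitely many level sets of \<open>s\<close> the function is
  \<open>f\<close> followed by the continuous map \<open>norm (y - i)\<close> for a constant
  \<open>i\<close>, so no measurability of subtraction is involved.\<close>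

lemma borel_measurable_norm_diff_simple:
  fixes f s :: "'a \<Rightarrow> 'b::real_normed_vector"
  assumes f: "f \<in> borel_measurable M" and s: "simple_function M s"
  shows "(\<lambda>x. norm (f x - s x)) \<in> borel_measurable M"
proof (rule measurable_compose_countable'[where I = "s ` space M" and g = s and f = "\<lambda>i x. norm (f x - i)"])
  show "(\<lambda>x. norm (f x - i)) \<in> borel_measurable M" for i
    by (rule measurable_compose[OF f])
       (intro borel_measurable_continuous_onI continuous_intros)
  show "s \<in> measurable M (count_space (s ` space M))"
    using measurable_simple_function[OF s] s
    by (intro measurable_count_space_eq2[THEN iffD2])
       (auto simp: simple_function_def)
  show "countable (s ` space M)"
    using s by (auto simp: simple_function_def intro: countable_finite)
qed

text \<open>Preimages under \<open>f\<close> and \<open>g\<close> differ by a null set, which is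
  measurable by completeness.\<close>

lemma (in complete_measure) measurable_cong_AE:
  assumes f: "f \<in> measurable M N" and eq: "AE x in M. f x = g x"
    and g: "\<And>x. x \<in> space M \<Longrightarrow> g x \<in> space N"
  shows "g \<in> measurable M N"
proof (rule measurableI)
  fix A assume "A \<in> sets N"
  then have fA: "f -` A \<inter> space M \<in> sets M" using f by auto
  have "AE x in M. x \<in> f -` A \<inter> space M \<longleftrightarrow> x \<in> g -` A \<inter> space M"
    using eq by eventually_elim auto
  then show "g -` A \<inter> space M \<in> sets M"
    by (rule in_sets_AE[OF _ fA]) auto
qed (use g in auto)

lemma linear_scaleC: "linear (\<lambda>x. c *\<^sub>C x :: 'b::complex_banach)"
proof (rule linearI)
  show "c *\<^sub>C (r *\<^sub>R x) = r *\<^sub>R (c *\<^sub>C x)" for r and x :: 'b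
    by (simp add: scaleR_eq_scaleC scaleC_scaleC mult.commute)
qed (simp add: scaleC_add_right)

lemma bounded_linear_scaleC: "bounded_linear (\<lambda>x. c *\<^sub>C x :: 'b::complex_banach)"
  by (rule bounded_linear_intro[of _ "cmod c"])
     (simp_all add: scaleC_add_right linear_cmul[OF linear_scaleC[of c]] norm_scaleC)

lemma scaleC_diff_right: "c *\<^sub>C (x - y) = c *\<^sub>C x - c *\<^sub>C (y :: 'b::complex_banach)"
  by (rule linear_diff[OF linear_scaleC])

lemma scaleC_one [simp]: "1 *\<^sub>C x = (x :: 'b::complex_banach)"
  using scaleR_eq_scaleC[of 1 x] by simp

lemma scaleC_minus_left: "(a - b) *\<^sub>C x = a *\<^sub>C x - b *\<^sub>C (x :: 'b::complex_banach)"
  using scaleC_add_left[of "a - b" b x] by simp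

text \<open>On a non-separable space the difference of two Borel functions need not be Borel; the
  measurability of its norm is recovered from the approximating simple functions.\<close>

lemma has_bochner_diff_scaleC:
  fixes f g :: "'a \<Rightarrow> 'b::complex_banach"
  assumes M: "complete_measure M" and f: "has_bochner M f I" and g: "has_bochner M g J"
  shows borel_measurable_norm_diff_scaleC:
      "(\<lambda>x. norm (f x - c *\<^sub>C g x)) \<in> borel_measurable M" (is "?n \<in> _")
    and norm_diff_scaleC_le:
      "ennreal (norm (I - c *\<^sub>C J)) \<le> (\<integral>\<^sup>+x. norm (f x - c *\<^sub>C g x) \<partial>M)"
proof -
  interpret complete_measure M by (rule M)
  obtain s where s: "\<And>i. Bochner_Integration.simple_bochner_integrable M (s i)"
    and s0: "(\<lambda>i. \<integral>\<^sup>+x. norm (f x - s i x) \<partial>M) \<longlonglongrightarrow> 0"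
    and sI: "(\<lambda>i. Bochner_Integration.simple_bochner_integral M (s i)) \<longlonglongrightarrow> I"
    and fm: "f \<in> borel_measurable M"
    using f unfolding has_bochner_def by blast
  obtain t where t: "\<And>i. Bochner_Integration.simple_bochner_integrable M (t i)"
    and t0: "(\<lambda>i. \<integral>\<^sup>+x. norm (g x - t i x) \<partial>M) \<longlonglongrightarrow> 0"
    and tJ: "(\<lambda>i. Bochner_Integration.simple_bochner_integral M (t i)) \<longlonglongrightarrow> J"
    and gm: "g \<in> borel_measurable M"
    using g unfolding has_bochner_def by blast
  have ss: "simple_function M (s i)" and ts: "simple_function M (t i)" for i
    using s t by (auto elim: simple_bochner_integrable.cases)
  define d where "d i x = norm (f x - s i x)" for i x
  define d' where "d' i x = norm (g x - t i x)" for i x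
  define e where "e i x = d i x + cmod c * d' i x" for i x
  define v where "v i x = norm (s i x - c *\<^sub>C t i x)" for i x
  have dm[measurable]: "d i \<in> borel_measurable M" "d' i \<in> borel_measurable M" for i
    unfolding d_def d'_def by (intro borel_measurable_norm_diff_simple fm gm ss ts)+
  have em[measurable]: "e i \<in> borel_measurable M" for i
    unfolding e_def by measurable
  have e_nonneg: "0 \<le> e i x" for i x by (simp add: e_def d_def d'_def)
  have vs: "Bochner_Integration.simple_bochner_integrable M (\<lambda>x. s i x - c *\<^sub>C t i x)" for i
    using s t linear_0[OF linear_scaleC]
    by (intro simple_bochner_integrable_compose2[where p = "\<lambda>x y. x - c *\<^sub>C y"]) auto
  have vn: "Bochner_Integration.simple_bochner_integrable M (v i)" for i
    unfolding v_def using s t linear_0[OF linear_scaleC]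
    by (intro simple_bochner_integrable_compose2[where p = "\<lambda>x y. norm (x - c *\<^sub>C y)"]) auto
  have vm[measurable]: "v i \<in> borel_measurable M" for i
    using vn[of i] by (auto intro: borel_measurable_simple_function elim: simple_bochner_integrable.cases)
  \<comment> \<open>The real function \<open>v i\<close> is measurable because it comes from simple
    functions. It approximates the norm in question up to the scalar error \<open>e i\<close>, whose
    integral tends to 0.\<close>
  have diff: "\<bar>v i x - norm (f x - c *\<^sub>C g x)\<bar> \<le> e i x" for i x
  proof -
    have "\<bar>v i x - norm (f x - c *\<^sub>C g x)\<bar>
        \<le> norm ((s i x - c *\<^sub>C t i x) - (f x - c *\<^sub>C g x))"
      unfolding v_def by (rule norm_triangle_ineq3)
    also have "(s i x - c *\<^sub>C t i x) - (f x - c *\<^sub>C g x)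
        = (s i x - f x) + c *\<^sub>C (g x - t i x)"
      by (simp add: scaleC_diff_right)
    also have "norm \<dots> \<le> norm (s i x - f x) + norm (c *\<^sub>C (g x - t i x))"
      by (rule norm_triangle_ineq)
    finally show ?thesis
      by (simp add: norm_scaleC e_def d_def d'_def norm_minus_commute)
  qed
  have e_int: "(\<integral>\<^sup>+x. ennreal (e i x) \<partial>M)
      = (\<integral>\<^sup>+x. norm (f x - s i x) \<partial>M) + ennreal (cmod c) * (\<integral>\<^sup>+x. norm (g x - t i x) \<partial>M)" for i
  proof -
    have "(\<integral>\<^sup>+x. ennreal (e i x) \<partial>M) = (\<integral>\<^sup>+x. ennreal (d i x) + ennreal (cmod c) * ennreal (d' i x) \<partial>M)"
      by (intro nn_integral_cong) (simp add: e_def d_def d'_def ennreal_mult)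
    also have "\<dots> = (\<integral>\<^sup>+x. ennreal (d i x) \<partial>M) + ennreal (cmod c) * (\<integral>\<^sup>+x. ennreal (d' i x) \<partial>M)"
      by (simp add: nn_integral_add nn_integral_cmult)
    finally show ?thesis by (simp add: d_def d'_def)
  qed
  have e0: "(\<lambda>i. \<integral>\<^sup>+x. ennreal (e i x) \<partial>M) \<longlonglongrightarrow> 0"
    using tendsto_add[OF s0 ennreal_tendsto_cmult[OF _ t0, of "ennreal (cmod c)"]]
    unfolding e_int by simp
  \<comment> \<open>The first few errors may have infinite integral. Dropping them makes all
    \<open>e (i + N)\<close> integrable, as the extraction of an almost everywhere convergent
    subsequence requires.\<close>
  obtain N where N: "\<And>i. i \<ge> N \<Longrightarrow> (\<integral>\<^sup>+x. ennreal (e i x) \<partial>M) < 1"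
    using order_tendstoD(2)[OF e0, of 1] by (auto simp: eventually_sequentially)
  have ei: "integrable M (e (i + N))" for i
    using N[of "i + N"] e_nonneg
    by (intro integrableI_nonneg) (auto intro: less_trans)
  have "(\<lambda>i. \<integral>x. norm (e (i + N) x) \<partial>M) \<longlonglongrightarrow> 0"
  proof -
    have "(\<integral>x. norm (e (i + N) x) \<partial>M) = enn2real (\<integral>\<^sup>+x. ennreal (e (i + N) x) \<partial>M)" for i
      using e_nonneg by (subst integral_eq_nn_integral) auto
    moreover have "(\<lambda>i. enn2real (\<integral>\<^sup>+x. ennreal (e (i + N) x) \<partial>M)) \<longlonglongrightarrow> enn2real 0"
      by (rule tendsto_enn2real) (use LIMSEQ_ignore_initial_segment[OF e0] in auto)
    ultimately show ?thesis by simp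
  qed
  from tendsto_L1_AE_subseq[OF ei this]
  obtain r where r: "strict_mono r" "AE x in M. (\<lambda>n. e (r n + N) x) \<longlonglongrightarrow> 0" by blast
  have lim: "AE x in M. lim (\<lambda>n. v (r n + N) x) = ?n x"
    using r(2)
  proof eventually_elim
    case (elim x)
    have "(\<lambda>n. v (r n + N) x - ?n x) \<longlonglongrightarrow> 0"
      by (rule Lim_null_comparison[OF _ elim]) (use diff in auto)
    then show ?case by (intro limI) (simp add: LIM_zero_iff)
  qed
  have limm: "(\<lambda>x. lim (\<lambda>n. v (r n + N) x)) \<in> borel_measurable M"
    by (rule borel_measurable_lim_metric) (rule vm)
  show nm: "?n \<in> borel_measurable M"
    by (rule measurable_cong_AE[OF limm lim]) auto
  \<comment> \<open>For simple functions the norm bound is finite-dimensional algebra; the price of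
    replacing them by \<open>f\<close> and \<open>g\<close> is the integral of \<open>e i\<close>,
    which disappears in the limit.\<close>
  have "ennreal (norm (Bochner_Integration.simple_bochner_integral M (s i) - c *\<^sub>C Bochner_Integration.simple_bochner_integral M (t i)))
      \<le> (\<integral>\<^sup>+x. ?n x \<partial>M) + (\<integral>\<^sup>+x. ennreal (e i x) \<partial>M)" for i
  proof -
    have ct: "Bochner_Integration.simple_bochner_integrable M (\<lambda>x. c *\<^sub>C t i x)"
      using simple_bochner_integrable_compose2[where p = "\<lambda>x y. c *\<^sub>C x", OF _ t t]
        linear_0[OF linear_scaleC] by auto
    have "Bochner_Integration.simple_bochner_integral M (s i) - c *\<^sub>C Bochner_Integration.simple_bochner_integral M (t i)
        = Bochner_Integration.simple_bochner_integral M (\<lambda>x. s i x - c *\<^sub>C t i x)"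
      using simple_bochner_integral_linear[OF linear_scaleC t] simple_bochner_integral_diff[OF s ct]
      by simp
    also have "ennreal (norm \<dots>) \<le> ennreal (Bochner_Integration.simple_bochner_integral M (v i))"
      unfolding v_def by (intro ennreal_leI simple_bochner_integral_norm_bound vs)
    also have "\<dots> = (\<integral>\<^sup>+x. ennreal (v i x) \<partial>M)"
      by (intro simple_bochner_integral_eq_nn_integral vn) (simp add: v_def)
    also have "\<dots> \<le> (\<integral>\<^sup>+x. ennreal (?n x) + ennreal (e i x) \<partial>M)"
      using diff[of i] e_nonneg[of i]
      by (intro nn_integral_mono) (smt (verit) ennreal_leI ennreal_plus norm_ge_zero)
    also have "\<dots> = (\<integral>\<^sup>+x. ?n x \<partial>M) + (\<integral>\<^sup>+x. ennreal (e i x) \<partial>M)"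
      using nm by (intro nn_integral_add) auto
    finally show ?thesis .
  qed
  moreover have "(\<lambda>i. ennreal (norm (Bochner_Integration.simple_bochner_integral M (s i) - c *\<^sub>C Bochner_Integration.simple_bochner_integral M (t i))))
      \<longlonglongrightarrow> ennreal (norm (I - c *\<^sub>C J))"
  proof -
    show ?thesis
      by (intro tendsto_ennrealI tendsto_norm tendsto_diff sI bounded_linear.tendsto[OF bounded_linear_scaleC tJ])
  qed
  moreover have "(\<lambda>i. (\<integral>\<^sup>+x. ?n x \<partial>M) + (\<integral>\<^sup>+x. ennreal (e i x) \<partial>M)) \<longlonglongrightarrow> (\<integral>\<^sup>+x. ?n x \<partial>M) + 0"
    by (intro tendsto_intros e0)
  ultimately show "ennreal (norm (I - c *\<^sub>C J)) \<le> (\<integral>\<^sup>+x. ?n x \<partial>M)"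
    by (auto intro: LIMSEQ_le)
qed

text \<open>The preceding inequality with \<open>g = f\<close> and \<open>c = 1\<close> has a
  vanishing right-hand side.\<close>

lemma has_bochner_unique:
  fixes f :: "'a \<Rightarrow> 'b::complex_banach"
  assumes "complete_measure M" "has_bochner M f I" "has_bochner M f J"
  shows "I = J"
  using norm_diff_scaleC_le[OF assms, of 1] by simp

lemma bochner_integral_eq:
  fixes f :: "'a \<Rightarrow> 'b::complex_banach"
  assumes "complete_measure M" "has_bochner M f I"
  shows "bochner_integral M f = I"
  unfolding bochner_integral_def using has_bochner_unique assms by blast

section \<open>Reflection and translation of Lebesgue integrals\<close>

lemma lebesgue_reflect_measurable: "(\<lambda>x. a - x) \<in> lebesgue \<rightarrow>\<^sub>M (lebesgue :: 'a::euclidean_space measure)"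
  and distr_lebesgue_reflect: "distr lebesgue lebesgue (\<lambda>x. a - x) = (lebesgue :: 'a measure)"
proof -
  have *: "(\<lambda>x. a + (\<Sum>j\<in>Basis. ((- 1) * (x \<bullet> j)) *\<^sub>R j)) = (\<lambda>x. a - x)"
    by (simp add: sum_negf euclidean_representation)
  show "(\<lambda>x. a - x) \<in> lebesgue \<rightarrow>\<^sub>M (lebesgue :: 'a measure)"
    using lebesgue_affine_measurable[of "\<lambda>_. - 1" a] unfolding * by simp
  show "distr lebesgue lebesgue (\<lambda>x. a - x) = (lebesgue :: 'a measure)"
    using lebesgue_affine_euclidean[of "\<lambda>_. - 1" a, symmetric] unfolding * by (simp add: density_1)
qed

lemma lebesgue_translate_measurable: "(\<lambda>x. a + x) \<in> lebesgue \<rightarrow>\<^sub>M (lebesgue :: 'a::euclidean_space measure)"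
  and distr_lebesgue_translate: "distr lebesgue lebesgue (\<lambda>x. a + x) = (lebesgue :: 'a measure)"
proof -
  have *: "(\<lambda>x. a + (\<Sum>j\<in>Basis. (1 * (x \<bullet> j)) *\<^sub>R j)) = (\<lambda>x. a + x)"
    by (simp add: euclidean_representation)
  show "(\<lambda>x. a + x) \<in> lebesgue \<rightarrow>\<^sub>M (lebesgue :: 'a measure)"
    using lebesgue_affine_measurable[of "\<lambda>_. 1" a] unfolding * by simp
  show "distr lebesgue lebesgue (\<lambda>x. a + x) = (lebesgue :: 'a measure)"
    using lebesgue_affine_euclidean[of "\<lambda>_. 1" a, symmetric] unfolding * by (simp add: density_1)
qed

lemma nn_integral_lebesgue_reflect:
  fixes f :: "'a::euclidean_space \<Rightarrow> ennreal"
  assumes "f \<in> borel_measurable lebesgue"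
  shows "(\<integral>\<^sup>+x. f (a - x) \<partial>lebesgue) = (\<integral>\<^sup>+x. f x \<partial>lebesgue)"
  using nn_integral_distr[OF lebesgue_reflect_measurable[of a], of f] assms
  by (simp add: distr_lebesgue_reflect)

lemma nn_integral_lebesgue_translate:
  fixes f :: "'a::euclidean_space \<Rightarrow> ennreal"
  assumes "f \<in> borel_measurable lebesgue"
  shows "(\<integral>\<^sup>+x. f (a + x) \<partial>lebesgue) = (\<integral>\<^sup>+x. f x \<partial>lebesgue)"
  using nn_integral_distr[OF lebesgue_translate_measurable[of a], of f] assms
  by (simp add: distr_lebesgue_translate)

text \<open>Reflecting the approximating simple functions changes neither their ranges nor the
  measures of their level sets, hence not their integrals.\<close>

lemma has_bochner_reflect:
  fixes f :: "'a::euclidean_space \<Rightarrow> 'b::real_normed_vector"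
  assumes "has_bochner lebesgue f I"
  shows "has_bochner lebesgue (\<lambda>x. f (a - x)) I"
proof -
  note T = lebesgue_reflect_measurable[of a]
  obtain s where s: "\<And>i. Bochner_Integration.simple_bochner_integrable lebesgue (s i)"
    and s0: "(\<lambda>i. \<integral>\<^sup>+x. norm (f x - s i x) \<partial>lebesgue) \<longlonglongrightarrow> 0"
    and sI: "(\<lambda>i. Bochner_Integration.simple_bochner_integral lebesgue (s i)) \<longlonglongrightarrow> I"
    and fm: "f \<in> borel_measurable lebesgue"
    using assms unfolding has_bochner_def by blast
  have ss: "simple_function lebesgue (s i)"
    and fin: "emeasure lebesgue {x \<in> space lebesgue. s i x \<noteq> 0} \<noteq> \<infinity>" for i
    using s[of i] by (auto elim: simple_bochner_integrable.cases)
  have level: "{x. s i x \<in> A} \<in> sets lebesgue" for i A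
    using simple_functionD(2)[OF ss, of i A] by (simp add: vimage_def)
  have em: "emeasure lebesgue {x. a - x \<in> A} = emeasure lebesgue A" if "A \<in> sets lebesgue" for A :: "'a set"
    using emeasure_distr[OF T that] by (simp add: distr_lebesgue_reflect vimage_def)
  \<comment> \<open>The integral of a simple function is a sum over its range, so the index sets of
    the two sums have to agree.\<close>
  have surj: "range (\<lambda>x. g (a - x)) = range g" for g :: "'a \<Rightarrow> 'c"
  proof -
    have "range g \<subseteq> range (\<lambda>x. g (a - x))"
    proof safe
      fix x show "g x \<in> range (\<lambda>x. g (a - x))" by (rule image_eqI[of _ _ "a - x"]) auto
    qed
    then show ?thesis by auto
  qed
  show ?thesis
    unfolding has_bochner_def
  proof (intro conjI exI[of _ "\<lambda>i x. s i (a - x)"] allI)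
    show "(\<lambda>x. f (a - x)) \<in> borel_measurable lebesgue"
      by (rule measurable_compose[OF T fm])
    show "Bochner_Integration.simple_bochner_integrable lebesgue (\<lambda>x. s i (a - x))" for i
    proof (rule simple_bochner_integrable.intros)
      show "simple_function lebesgue (\<lambda>x. s i (a - x))"
        using simple_function_comp[OF T ss] .
      show "emeasure lebesgue {x \<in> space lebesgue. s i (a - x) \<noteq> 0} \<noteq> \<infinity>"
        using em[OF level[of i "- {0}"]] fin[of i] by (simp del: emeasure_completion)
    qed
    have "(\<integral>\<^sup>+x. norm (f (a - x) - s i (a - x)) \<partial>lebesgue) = (\<integral>\<^sup>+x. norm (f x - s i x) \<partial>lebesgue)" for i
      using borel_measurable_norm_diff_simple[OF fm ss]
      by (intro nn_integral_lebesgue_reflect) auto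
    then show "(\<lambda>i. \<integral>\<^sup>+x. norm (f (a - x) - s i (a - x)) \<partial>lebesgue) \<longlonglongrightarrow> 0"
      using s0 by simp
    have "Bochner_Integration.simple_bochner_integral lebesgue (\<lambda>x. s i (a - x)) = Bochner_Integration.simple_bochner_integral lebesgue (s i)" for i
    proof -
      have "measure lebesgue {x \<in> space lebesgue. s i (a - x) = y} = measure lebesgue {x \<in> space lebesgue. s i x = y}" for y
        using em[OF level[of i "{y}"]] unfolding measure_def
        by (simp only: mem_Collect_eq singleton_iff space_completion space_lborel space_borel UNIV_I simp_thms)
      then show ?thesis
        unfolding simple_bochner_integral_def by (simp add: surj del: measure_completion)
    qed
    then show "(\<lambda>i. Bochner_Integration.simple_bochner_integral lebesgue (\<lambda>x. s i (a - x))) \<longlonglongrightarrow> I"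
      using sI by simp
  qed
qed

section \<open>Continuity of translations in the mean\<close>

text \<open>An inner closed set becomes compact after intersection with a large ball; what the ball
  cuts off is small by continuity from above, since \<open>A\<close> has finite measure. The three
  errors take \<open>e/3\<close> each.\<close>

lemma fmeasurable_inner_compact_outer_open:
  fixes A :: "'a::euclidean_space set"
  assumes A: "A \<in> lmeasurable" and e: "0 < e"
  obtains K U where "compact K" "open U" "K \<subseteq> A" "A \<subseteq> U" "U - K \<in> sets lebesgue"
    "emeasure lebesgue (U - K) < ennreal e"
proof -
  have As: "A \<in> sets lebesgue" and Afin: "emeasure lebesgue A < \<infinity>"
    using A by (auto simp: fmeasurable_def)
  have e3: "0 < e / 3" using e by simp
  obtain U where U: "open U" "A \<subseteq> U" "U - A \<in> lmeasurable" "emeasure lebesgue (U - A) < ennreal (e/3)"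
    using sets_lebesgue_outer_open[OF As e3] .
  obtain C where C: "closed C" "C \<subseteq> A" "A - C \<in> lmeasurable" "emeasure lebesgue (A - C) < ennreal (e/3)"
    using sets_lebesgue_inner_closed[OF As e3] .
  have Cs: "C \<in> sets lebesgue" using C(1) by (simp add: borel_closed sets_completionI_sets)
  have "(\<lambda>n. emeasure lebesgue (C - cball 0 (real n))) \<longlonglongrightarrow> emeasure lebesgue (\<Inter>n. C - cball 0 (real n))"
  proof (rule Lim_emeasure_decseq)
    show "range (\<lambda>n. C - cball 0 (real n)) \<subseteq> sets lebesgue" using Cs by auto
    show "decseq (\<lambda>n. C - cball 0 (real n))" by (auto simp: decseq_def)
    have "emeasure lebesgue (C - cball 0 (real n)) \<le> emeasure lebesgue A" for n
      using C(2) by (intro emeasure_mono As) auto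
    then show "emeasure lebesgue (C - cball 0 (real n)) \<noteq> \<infinity>" for n
      using Afin by (metis infinity_ennreal_def leD)
  qed
  also have "(\<Inter>n. C - cball 0 (real n)) = {}"
    using real_arch_simple by force
  finally have "\<forall>\<^sub>F n in sequentially. emeasure lebesgue (C - cball 0 (real n)) < ennreal (e/3)"
    using e3 by (intro order_tendstoD(2)) (auto simp del: emeasure_completion)
  then obtain n where n: "emeasure lebesgue (C - cball 0 (real n)) < ennreal (e/3)"
    by (auto simp: eventually_sequentially)
  define K where "K = C \<inter> cball 0 (real n)"
  have Ks: "K \<in> sets lebesgue" using Cs by (auto simp: K_def)
  have Us: "U \<in> sets lebesgue" using U(1) by (simp add: borel_open sets_completionI_sets)
  show ?thesis
  proof
    show "compact K" unfolding K_def using C(1) by (simp add: closed_Int_compact)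
    show "open U" "K \<subseteq> A" "A \<subseteq> U" using U C by (auto simp: K_def)
    show "U - K \<in> sets lebesgue" using Us Ks by auto
    have m: "U - A \<in> sets lebesgue" "A - C \<in> sets lebesgue" "C - cball 0 (real n) \<in> sets lebesgue"
      using Us As Cs by auto
    have "emeasure lebesgue (U - K) \<le> emeasure lebesgue ((U - A) \<union> ((A - C) \<union> (C - cball 0 (real n))))"
      by (rule emeasure_mono) (use m in \<open>auto simp: K_def\<close>)
    also have "\<dots> \<le> emeasure lebesgue (U - A) + emeasure lebesgue ((A - C) \<union> (C - cball 0 (real n)))"
      by (rule emeasure_subadditive) (use m in auto)
    also have "\<dots> \<le> emeasure lebesgue (U - A) + (emeasure lebesgue (A - C) + emeasure lebesgue (C - cball 0 (real n)))"
      by (intro add_left_mono emeasure_subadditive m)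
    also have "\<dots> < ennreal (e/3) + (ennreal (e/3) + ennreal (e/3))"
      by (intro add_strict_mono U C n)
    also have "\<dots> = ennreal e" using e by (simp flip: ennreal_plus)
    finally show "emeasure lebesgue (U - K) < ennreal e" .
  qed
qed

text \<open>If \<open>v\<close> is shorter than the distance by which \<open>K\<close> can be
  enlarged inside \<open>U\<close>, then a point with exactly one of \<open>x\<close>,
  \<open>v + x\<close> in \<open>A\<close> has \<open>x\<close> or \<open>v + x\<close> in
  \<open>U - K\<close>. Both possibilities cost the measure of \<open>U - K\<close>, hence
  \<open>e/2\<close>.\<close>

lemma nn_integral_indicator_translate_le:
  fixes A :: "'a::euclidean_space set"
  assumes A: "A \<in> lmeasurable" and e: "0 < e"
  shows "\<forall>\<^sub>F v in at 0. (\<integral>\<^sup>+x. ennreal \<bar>indicator A (v + x) - indicator A x\<bar> \<partial>lebesgue) \<le> ennreal e"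
proof -
  have "0 < e / 2" using e by simp
  then obtain K U where KU: "compact K" "open U" "K \<subseteq> A" "A \<subseteq> U" and D: "U - K \<in> sets lebesgue"
    and less: "emeasure lebesgue (U - K) < ennreal (e/2)"
    using fmeasurable_inner_compact_outer_open[OF A] by metis
  obtain d where d: "d > 0" "(\<Union>x\<in>K. ball x d) \<subseteq> U"
    using compact_subset_open_imp_ball_epsilon_subset[OF KU(1,2)] KU by blast
  have "(\<integral>\<^sup>+x. ennreal \<bar>indicator A (v + x) - indicator A x\<bar> \<partial>lebesgue) \<le> ennreal e"
    if v: "dist v 0 < d" for v
  proof -
    have K: "v + x \<in> U" "x - v \<in> U" if "x \<in> K" for x
      using d(2) v that by (force simp: dist_norm)+
    have "ennreal \<bar>indicator A (v + x) - indicator A x\<bar>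
        \<le> indicator (U - K) (v + x) + indicator (U - K) x" for x
      using K(1)[of x] K(2)[of "v + x"] KU(3,4) by (auto simp: indicator_def)
    then have "(\<integral>\<^sup>+x. ennreal \<bar>indicator A (v + x) - indicator A x\<bar> \<partial>lebesgue)
        \<le> (\<integral>\<^sup>+x. indicator (U - K) (v + x) + indicator (U - K) x \<partial>lebesgue)"
      by (intro nn_integral_mono)
    also have "\<dots> = (\<integral>\<^sup>+x. indicator (U - K) (v + x) \<partial>lebesgue) + (\<integral>\<^sup>+x. indicator (U - K) x \<partial>lebesgue)"
      using D by (intro nn_integral_add measurable_compose[OF lebesgue_translate_measurable]) auto
    also have "\<dots> = emeasure lebesgue (U - K) + emeasure lebesgue (U - K)"
      using D by (subst nn_integral_lebesgue_translate) (auto simp del: emeasure_completion)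
    also have "\<dots> \<le> ennreal (e/2) + ennreal (e/2)"
      using less by (intro add_mono) auto
    also have "\<dots> = ennreal e" using e by (simp flip: ennreal_plus)
    finally show ?thesis .
  qed
  then show ?thesis using d(1) by (auto simp: eventually_at)
qed

lemma borel_measurable_norm_translate_diff:
  fixes f :: "'a::euclidean_space \<Rightarrow> 'b::{banach, second_countable_topology}"
  assumes "f \<in> borel_measurable lebesgue"
  shows "(\<lambda>x. ennreal (norm (f (v + x) - f x))) \<in> borel_measurable lebesgue"
proof -
  have "(\<lambda>x. f (v + x)) \<in> borel_measurable lebesgue"
    by (rule measurable_compose[OF lebesgue_translate_measurable assms])
  then show ?thesis using assms by measurable
qed

text \<open>The property passes from indicators to sums, and to dominated limits because translation
  preserves the error of an approximation in the mean.\<close>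

proposition L1_translation_continuous:
  fixes f :: "'a::euclidean_space \<Rightarrow> 'b::{banach, second_countable_topology}"
  assumes "integrable lebesgue f" and e: "0 < e"
  shows "\<forall>\<^sub>F v in at 0. (\<integral>\<^sup>+x. norm (f (v + x) - f x) \<partial>lebesgue) \<le> ennreal e"
  using assms
proof (induction arbitrary: e rule: integrable_induct)
  case (base A c)
  have A: "A \<in> lmeasurable" using base by (auto simp: fmeasurable_def)
  \<comment> \<open>The summand 1 covers \<open>c = 0\<close>.\<close>
  have "0 < e / (norm c + 1)" using \<open>0 < e\<close> by (intro divide_pos_pos) (auto intro: add_nonneg_pos)
  from nn_integral_indicator_translate_le[OF A this]
  show ?case
  proof eventually_elim
    case (elim v)
    have m: "(\<lambda>x. ennreal \<bar>indicator A (v + x) - indicator A x\<bar>) \<in> borel_measurable lebesgue"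
      using base by (intro measurable_compose[OF _ measurable_ennreal] borel_measurable_abs
        borel_measurable_diff measurable_compose[OF lebesgue_translate_measurable]) auto
    have "(\<integral>\<^sup>+x. norm (indicat_real A (v + x) *\<^sub>R c - indicat_real A x *\<^sub>R c) \<partial>lebesgue)
        = (\<integral>\<^sup>+x. ennreal (norm c) * ennreal \<bar>indicator A (v + x) - indicator A x\<bar> \<partial>lebesgue)"
      by (intro nn_integral_cong) (auto simp: indicator_def)
    also have "\<dots> = ennreal (norm c) * (\<integral>\<^sup>+x. ennreal \<bar>indicator A (v + x) - indicator A x\<bar> \<partial>lebesgue)"
      by (rule nn_integral_cmult[OF m])
    also have "\<dots> \<le> ennreal (norm c) * ennreal (e / (norm c + 1))"
      by (intro mult_left_mono elim) auto
    also have "\<dots> = ennreal (norm c * (e / (norm c + 1)))"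
      using \<open>0 < e\<close> by (intro ennreal_mult[symmetric]) (auto intro!: divide_nonneg_nonneg)
    also have "\<dots> \<le> ennreal e"
    proof (rule ennreal_leI)
      have "norm c * e \<le> e * (norm c + 1)" using \<open>0 < e\<close> by (simp add: algebra_simps)
      then show "norm c * (e / (norm c + 1)) \<le> e"
        using norm_ge_zero[of c] by (simp add: divide_le_eq add_nonneg_pos)
    qed
    finally show ?case .
  qed
next
  case (add f g)
  have "0 < e / 2" using add.prems by simp
  with add.IH have "\<forall>\<^sub>F v in at 0. (\<integral>\<^sup>+x. norm (f (v + x) - f x) \<partial>lebesgue) \<le> ennreal (e/2)"
    "\<forall>\<^sub>F v in at 0. (\<integral>\<^sup>+x. norm (g (v + x) - g x) \<partial>lebesgue) \<le> ennreal (e/2)" by blast+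
  then show ?case
  proof eventually_elim
    case (elim v)
    have m: "(\<lambda>x. ennreal (norm (f (v + x) - f x))) \<in> borel_measurable lebesgue"
      "(\<lambda>x. ennreal (norm (g (v + x) - g x))) \<in> borel_measurable lebesgue"
      by (rule borel_measurable_norm_translate_diff[OF borel_measurable_integrable[OF add.hyps(1)]],
          rule borel_measurable_norm_translate_diff[OF borel_measurable_integrable[OF add.hyps(2)]])
    have "(\<integral>\<^sup>+x. norm (f (v + x) + g (v + x) - (f x + g x)) \<partial>lebesgue)
        \<le> (\<integral>\<^sup>+x. ennreal (norm (f (v + x) - f x)) + ennreal (norm (g (v + x) - g x)) \<partial>lebesgue)"
      by (intro nn_integral_mono) (simp add: norm_diff_triangle_ineq flip: ennreal_plus)
    also have "\<dots> = (\<integral>\<^sup>+x. norm (f (v + x) - f x) \<partial>lebesgue) + (\<integral>\<^sup>+x. norm (g (v + x) - g x) \<partial>lebesgue)"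
      by (rule nn_integral_add[OF m])
    also have "\<dots> \<le> ennreal (e/2) + ennreal (e/2)"
      by (intro add_mono elim)
    also have "\<dots> = ennreal e" using add.prems by (simp flip: ennreal_plus)
    finally show ?case .
  qed
next
  case (lim f s)
  have fm: "f \<in> borel_measurable lebesgue" and sm: "s i \<in> borel_measurable lebesgue" for i
    using lim.hyps by auto
  have "(\<lambda>i. \<integral>\<^sup>+x. ennreal (norm (f x - s i x)) \<partial>lebesgue) \<longlonglongrightarrow> 0"
  proof (rule nn_integral_dominated_convergence_norm[where w = "\<lambda>x. 2 * norm (f x)"])
    show "(\<integral>\<^sup>+x. ennreal (2 * norm (f x)) \<partial>lebesgue) < \<infinity>"
      using lim.hyps(4) fm
      by (subst ennreal_mult) (auto simp: integrable_iff_bounded nn_integral_cmult ennreal_mult_less_top)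
  qed (use lim.hyps fm sm in \<open>auto intro!: AE_I2\<close>)
  then have "\<forall>\<^sub>F i in sequentially. (\<integral>\<^sup>+x. ennreal (norm (s i x - f x)) \<partial>lebesgue) < ennreal (e / 3)"
    using lim.prems by (intro order_tendstoD(2)) (auto simp: norm_minus_commute)
  then obtain i where i: "(\<integral>\<^sup>+x. ennreal (norm (s i x - f x)) \<partial>lebesgue) < ennreal (e / 3)"
    by (auto simp: eventually_sequentially)
  have "\<forall>\<^sub>F v in at 0. (\<integral>\<^sup>+x. norm (s i (v + x) - s i x) \<partial>lebesgue) \<le> ennreal (e / 3)"
    using lim.prems by (intro lim.IH) auto
  then show ?case
  proof eventually_elim
    case (elim v)
    let ?d = "\<lambda>x. ennreal (norm (s i x - f x))"
    have d: "?d \<in> borel_measurable lebesgue"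
      using fm sm by measurable
    have d': "(\<lambda>x. ?d (v + x)) \<in> borel_measurable lebesgue"
      by (rule measurable_compose[OF lebesgue_translate_measurable d])
    have s: "(\<lambda>x. ennreal (norm (s i (v + x) - s i x))) \<in> borel_measurable lebesgue"
      by (rule borel_measurable_norm_translate_diff[OF sm])
    have "(\<integral>\<^sup>+x. norm (f (v + x) - f x) \<partial>lebesgue)
        \<le> (\<integral>\<^sup>+x. ?d (v + x) + (ennreal (norm (s i (v + x) - s i x)) + ?d x) \<partial>lebesgue)"
    proof (rule nn_integral_mono)
      fix x
      have "norm (f (v + x) - f x)
        \<le> norm (s i (v + x) - f (v + x)) + (norm (s i (v + x) - s i x) + norm (s i x - f x))"
        by (smt (verit, ccfv_threshold) norm_minus_commute norm_triangle_sub norm_diff_triangle_le order_refl)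
      then show "ennreal (norm (f (v + x) - f x)) \<le> ?d (v + x) + (ennreal (norm (s i (v + x) - s i x)) + ?d x)"
        by (simp flip: ennreal_plus)
    qed
    also have "\<dots> = (\<integral>\<^sup>+x. ?d (v + x) \<partial>lebesgue)
        + ((\<integral>\<^sup>+x. norm (s i (v + x) - s i x) \<partial>lebesgue) + (\<integral>\<^sup>+x. ?d x \<partial>lebesgue))"
      by (subst nn_integral_add[OF d'], (intro borel_measurable_add s d)[1], subst nn_integral_add[OF s d], rule refl)
    also have "\<dots> \<le> ennreal (e/3) + (ennreal (e/3) + ennreal (e/3))"
      using i elim nn_integral_lebesgue_translate[OF d, of v] by (intro add_mono) auto
    also have "\<dots> = ennreal e" using lim.prems by (simp flip: ennreal_plus)
    finally show ?case .
  qed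
qed

section \<open>Continuity of the convolution\<close>

lemma has_bochner_conv:
  assumes "bochner_integrable lebesgue (\<lambda>\<sigma>. h \<sigma> *\<^sub>C F (t - \<sigma>) x)"
  shows "has_bochner lebesgue (\<lambda>\<sigma>. h \<sigma> *\<^sub>C F (t - \<sigma>) x) (conv h F t x)"
  using assms unfolding conv_def bochner_integrable_def
  by (auto simp: bochner_integral_eq[OF completion.complete_measure_axioms])

text \<open>In this form \<open>t\<close> occurs in \<open>h\<close> alone, so that a shift of
  \<open>t\<close> is a translation of an integrable function and asks no regularity of
  \<open>F\<close>.\<close>

lemma has_bochner_conv_reflect:
  assumes "bochner_integrable lebesgue (\<lambda>\<sigma>. h \<sigma> *\<^sub>C F (t - \<sigma>) x)"
  shows "has_bochner lebesgue (\<lambda>s. h (t - s) *\<^sub>C F s x) (conv h F t x)"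
  using has_bochner_reflect[OF has_bochner_conv[of h F t x, OF assms], of t] by simp

text \<open>The increment is at most \<open>C\<close> times the distance in the mean between
  \<open>h\<close> and its translate by \<open>v\<close>.\<close>

lemma conv_continuous:
  fixes F :: "real^'n \<Rightarrow> 'x \<Rightarrow> 'y::complex_banach"
  assumes h: "integrable lebesgue h" and F: "\<And>t. norm (F t x) \<le> C"
    and conv: "\<And>t. bochner_integrable lebesgue (\<lambda>\<sigma>. h \<sigma> *\<^sub>C F (t - \<sigma>) x)"
  shows "continuous_on UNIV (\<lambda>t. conv h F t x)"
proof -
  have C: "0 \<le> C" using F[of 0] norm_ge_zero order_trans by blast
  have hm: "h \<in> borel_measurable lebesgue" using h by auto
  have "((\<lambda>v. conv h F (t + v) x) \<longlongrightarrow> conv h F t x) (at 0)" for t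
  proof (rule tendstoI)
    fix e :: real assume e: "0 < e"
    define e' where "e' = e / (2 * (C + 1))"
    have e': "0 < e'" "C * e' < e"
      using e C by (auto simp: e'_def field_simps intro: add_nonneg_pos)
    show "\<forall>\<^sub>F v in at 0. dist (conv h F (t + v) x) (conv h F t x) < e"
      using L1_translation_continuous[OF h e'(1)]
    proof eventually_elim
      case (elim v)
      let ?g = "\<lambda>y. ennreal (norm (h (v + y) - h y))"
      have g: "?g \<in> borel_measurable lebesgue"
        by (rule borel_measurable_norm_translate_diff[OF hm])
      have "ennreal (norm (conv h F (t + v) x - conv h F t x))
          \<le> (\<integral>\<^sup>+s. norm (h (t + v - s) *\<^sub>C F s x - h (t - s) *\<^sub>C F s x) \<partial>lebesgue)"
        using norm_diff_scaleC_le[OF completion.complete_measure_axioms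
          has_bochner_conv_reflect[of h F "t + v" x, OF conv]
          has_bochner_conv_reflect[of h F t x, OF conv], of 1] by simp
      also have "\<dots> \<le> (\<integral>\<^sup>+s. ennreal C * ?g (t - s) \<partial>lebesgue)"
      proof (rule nn_integral_mono)
        fix s
        have "norm (h (t + v - s) *\<^sub>C F s x - h (t - s) *\<^sub>C F s x)
            = norm (h (v + (t - s)) - h (t - s)) * norm (F s x)"
          by (simp add: norm_scaleC algebra_simps flip: scaleC_minus_left)
        also have "\<dots> \<le> norm (h (v + (t - s)) - h (t - s)) * C"
          by (intro mult_left_mono F) auto
        finally show "ennreal (norm (h (t + v - s) *\<^sub>C F s x - h (t - s) *\<^sub>C F s x)) \<le> ennreal C * ?g (t - s)"
          using C by (simp add: mult.commute ennreal_leI flip: ennreal_mult)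
      qed
      also have "\<dots> = (\<integral>\<^sup>+s. ennreal C * ?g s \<partial>lebesgue)"
        by (rule nn_integral_lebesgue_reflect) (rule borel_measurable_times_ennreal[OF borel_measurable_const g])
      also have "\<dots> = ennreal C * (\<integral>\<^sup>+s. ?g s \<partial>lebesgue)"
        by (rule nn_integral_cmult[OF g])
      also have "\<dots> \<le> ennreal C * ennreal e'"
        by (intro mult_left_mono elim) auto
      also have "\<dots> < ennreal e"
        using C e' e by (simp add: ennreal_lessI flip: ennreal_mult)
      finally show ?case
        by (simp add: dist_norm ennreal_less_iff)
    qed
  qed
  then show ?thesis
    by (simp add: continuous_on_eq_continuous_at isCont_iff)
qed

section \<open>Variable exponent norms\<close>

lemma top_not_le_one [simp]: "\<not> (top :: ennreal) \<le> 1"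
  by (simp only: not_le ennreal_one_less_top)

lemma phi_pow_mono: "s \<le> t \<Longrightarrow> phi_pow r s \<le> phi_pow r t"
proof (cases "r = \<infinity> \<or> t = \<infinity>")
  case False
  assume st: "s \<le> t"
  then have "s \<noteq> \<infinity>" using False by (auto simp: top_unique)
  moreover have "enn2real s \<le> enn2real t"
    using False st by (intro enn2real_mono) (auto simp: less_top)
  ultimately show ?thesis
    using False by (auto simp: phi_pow_def intro!: ennreal_leI powr_mono2)
qed (auto simp: phi_pow_def top_unique)

lemma phi_pow_ge:
  assumes r: "1 \<le> r" and t: "1 < t"
  shows "t \<le> phi_pow r t"
proof (cases "r = \<infinity> \<or> t = \<infinity>")
  case False
  then obtain R T where R: "r = ennreal R" "0 \<le> R" and T: "t = ennreal T" "0 \<le> T"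
    by (metis ennreal_cases infinity_ennreal_def)
  have "1 \<le> R" "1 < T"
    using r t R T by (auto simp flip: ennreal_1 simp: ennreal_le_iff ennreal_less_iff)
  then have "T powr 1 \<le> T powr R" by (intro powr_mono) auto
  then show ?thesis
    using R T \<open>1 < T\<close> by (simp add: phi_pow_def ennreal_leI)
qed (use t in \<open>auto simp: phi_pow_def leD\<close>)

text \<open>For finite exponents this is Young's inequality with the factors \<open>1/P\<close> and
  \<open>1/Q\<close> enlarged to 1. If one exponent is infinite, the other is 1: a first factor of
  at most 1 leaves the second, and a larger one makes the right-hand side infinite.\<close>

lemma phi_pow_Young:
  assumes p: "1 \<le> p" and q: "1 \<le> q" and pq: "inverse p + inverse q = 1" and x: "0 \<le> x" and y: "0 \<le> y"
  shows "ennreal x * ennreal y \<le> phi_pow p (ennreal x) + phi_pow q (ennreal y)"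
proof -
  have inf: "ennreal x * ennreal y \<le> phi_pow \<infinity> (ennreal x) + phi_pow q (ennreal y)"
    if "inverse q = 1" "0 \<le> x" "0 \<le> y" for x y and q :: ennreal
  proof (cases "x \<le> 1")
    case True
    have "q = 1" 
    proof (cases q)
      case (real Q)
      then show ?thesis using that(1)
        by (cases "Q = 0") (auto simp: inverse_ennreal ennreal_eq_1 simp flip: ennreal_1)
    qed (use that(1) in auto)
    moreover have "ennreal x * ennreal y \<le> ennreal y"
      using True that by (simp add: mult_left_le_one_le ennreal_leI flip: ennreal_mult)
    ultimately show ?thesis using that by (simp add: phi_pow_def add_increasing)
  next
    case False
    then show ?thesis by (simp add: phi_pow_def)
  qed
  consider "p = \<infinity>" | "q = \<infinity>" | "p \<noteq> \<infinity>" "q \<noteq> \<infinity>" by blast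
  then show ?thesis
  proof cases
    case 1 then show ?thesis using inf[of q x y] pq x y by simp
  next
    case 2 then show ?thesis using inf[of p y x] pq x y by (simp add: ac_simps)
  next
    case 3
    then obtain P Q where P: "p = ennreal P" "0 \<le> P" and Q: "q = ennreal Q" "0 \<le> Q"
      by (metis ennreal_cases infinity_ennreal_def)
    have PQ: "1 \<le> P" "1 \<le> Q" using p q P Q by (auto simp flip: ennreal_1)
    have "ennreal (inverse P + inverse Q) = ennreal 1"
      using pq P Q PQ by (simp add: inverse_ennreal)
    then have s: "1/P + 1/Q = 1"
      using PQ by (subst (asm) ennreal_inj) (auto simp: inverse_eq_divide)
    then have "P \<noteq> 1" "Q \<noteq> 1" using PQ by auto
    then have "1 < P" "1 < Q" using PQ by auto
    then have "x * y \<le> x powr P / P + y powr Q / Q"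
      using Youngs_inequality[OF _ _ s x y] by simp
    also have "\<dots> \<le> x powr P + y powr Q"
      using PQ by (intro add_mono) (auto simp: divide_le_eq mult_le_cancel_left1)
    finally show ?thesis
      using x y P Q by (simp add: phi_pow_def ennreal_leI flip: ennreal_mult ennreal_plus)
  qed
qed

lemma borel_measurable_phi_pow:
  assumes [measurable]: "p \<in> borel_measurable M" "f \<in> borel_measurable M"
  shows "(\<lambda>u. phi_pow (p u) (f u)) \<in> borel_measurable M"
  unfolding phi_pow_def by measurable

lemma lux_norm_le:
  assumes f: "f \<in> borel_measurable (lebesgue_on \<Omega>)" and r: "0 < r" and le: "var_modular \<Omega> p (\<lambda>u. f u / r) \<le> 1"
  shows "lux_norm \<Omega> p f \<le> ennreal r"
proof -
  have "f \<in> var_Lp \<Omega> p"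
    unfolding var_Lp_def using f r le
    by (auto intro!: exI[of _ "1 / r"] simp: order_le_less_trans[of _ 1])
  then show ?thesis
    unfolding lux_norm_def using r le by (auto intro!: Inf_lower)
qed

text \<open>For \<open>r < b\<close> the quotient exceeds 1 on a set of measure at least 1, and
  \<open>phi_pow\<close> does not decrease arguments above 1; the modular then exceeds 1, so
  \<open>r\<close> is not admissible. Outside the space the norm is infinite.\<close>

lemma lux_norm_ge:
  assumes p: "p \<in> var_exponents \<Omega>" and \<Omega>: "\<Omega> \<in> sets lebesgue" "1 \<le> emeasure lebesgue \<Omega>"
    and b: "0 < b" "\<And>u. u \<in> \<Omega> \<Longrightarrow> b \<le> \<bar>f u\<bar>"
  shows "ennreal b \<le> lux_norm \<Omega> p f"
proof -
  have "b \<le> r" if r: "0 < r" and le: "var_modular \<Omega> p (\<lambda>u. f u / r) \<le> 1" for r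
  proof (rule ccontr)
    assume "\<not> b \<le> r"
    then have br: "1 < b / r" using r by simp
    have "ennreal (b / r) * 1 \<le> ennreal (b / r) * emeasure lebesgue \<Omega>"
      by (intro mult_left_mono \<Omega>) auto
    also have "\<dots> = (\<integral>\<^sup>+u. ennreal (b / r) \<partial>lebesgue_on \<Omega>)"
      using \<Omega> by (simp add: emeasure_restrict_space del: emeasure_completion)
    also have "\<dots> \<le> var_modular \<Omega> p (\<lambda>u. f u / r)"
      unfolding var_modular_def
    proof (rule nn_integral_mono)
      fix u assume "u \<in> space (lebesgue_on \<Omega>)"
      then have u: "u \<in> \<Omega>" by simp
      have *: "b / r \<le> \<bar>f u / r\<bar>"
        using b(2)[OF u] r by (simp add: divide_right_mono)
      then have "1 < ennreal \<bar>f u / r\<bar>" using br by (simp flip: ennreal_1 add: ennreal_less_iff)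
      then have "ennreal \<bar>f u / r\<bar> \<le> phi_pow (p u) (ennreal \<bar>f u / r\<bar>)"
        using p u by (intro phi_pow_ge) (auto simp: var_exponents_def)
      then show "ennreal (b / r) \<le> phi_pow (p u) (ennreal \<bar>f u / r\<bar>)"
        using * by (meson ennreal_leI order_trans)
    qed
    also note le
    finally have "ennreal (b / r) \<le> ennreal 1" by simp
    then show False using br by (subst (asm) ennreal_le_iff) auto
  qed
  then show ?thesis
    unfolding lux_norm_def by (auto intro!: Inf_greatest ennreal_leI)
qed

text \<open>Young's inequality for \<open>f / r\<close> and \<open>g / s\<close> with admissible
  \<open>r\<close> and \<open>s\<close> integrates to at most \<open>1 + 1\<close>. The infimum is
  then taken in \<open>r\<close> and in \<open>s\<close> separately. A positive real bound
  \<open>\<beta>\<close> in place of the norm of \<open>f\<close> excludes a product of 0 and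
  infinity and is what the far cells provide.\<close>

lemma lux_norm_Hoelder:
  assumes p: "p \<in> var_exponents \<Omega>" and q: "q \<in> var_exponents \<Omega>"
    and pq: "AE u in lebesgue_on \<Omega>. inverse (p u) + inverse (q u) = 1"
    and f: "lux_norm \<Omega> p f \<le> ennreal \<beta>" and \<beta>: "0 < \<beta>"
  shows "(\<integral>\<^sup>+u. ennreal \<bar>f u\<bar> * ennreal \<bar>g u\<bar> \<partial>lebesgue_on \<Omega>) \<le> 2 * ennreal \<beta> * lux_norm \<Omega> q g"
proof (cases "g \<in> var_Lp \<Omega> q")
  case False
  then show ?thesis using \<beta> by (simp add: lux_norm_def ennreal_mult_top)
next
  case True
  then have gm: "g \<in> borel_measurable (lebesgue_on \<Omega>)" by (simp add: var_Lp_def)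
  have fL: "f \<in> var_Lp \<Omega> p" using f by (auto simp: lux_norm_def top_unique split: if_splits)
  then have fm: "f \<in> borel_measurable (lebesgue_on \<Omega>)" by (simp add: var_Lp_def)
  have pm: "p \<in> borel_measurable (lebesgue_on \<Omega>)" and qm: "q \<in> borel_measurable (lebesgue_on \<Omega>)"
    using p q by (auto simp: var_exponents_def)
  let ?I = "\<integral>\<^sup>+u. ennreal \<bar>f u\<bar> * ennreal \<bar>g u\<bar> \<partial>lebesgue_on \<Omega>"
  let ?R = "{r. 0 < r \<and> var_modular \<Omega> p (\<lambda>u. f u / r) \<le> 1}"
  let ?S = "{s. 0 < s \<and> var_modular \<Omega> q (\<lambda>u. g u / s) \<le> 1}"
  have *: "?I \<le> (2 * ennreal s) * ennreal r" if "r \<in> ?R" "s \<in> ?S" for r s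
  proof -
    from that have r: "0 < r" "var_modular \<Omega> p (\<lambda>u. f u / r) \<le> 1"
      and s: "0 < s" "var_modular \<Omega> q (\<lambda>u. g u / s) \<le> 1" by auto
    have m: "(\<lambda>u. ennreal \<bar>f u / r\<bar> * ennreal \<bar>g u / s\<bar>) \<in> borel_measurable (lebesgue_on \<Omega>)"
      using fm gm by measurable
    have "?I = (\<integral>\<^sup>+u. ennreal (r * s) * (ennreal \<bar>f u / r\<bar> * ennreal \<bar>g u / s\<bar>) \<partial>lebesgue_on \<Omega>)"
      using r s by (intro nn_integral_cong) (simp add: abs_mult field_simps flip: ennreal_mult)
    also have "\<dots> = ennreal (r * s) * (\<integral>\<^sup>+u. ennreal \<bar>f u / r\<bar> * ennreal \<bar>g u / s\<bar> \<partial>lebesgue_on \<Omega>)"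
      by (rule nn_integral_cmult[OF m])
    also have "\<dots> \<le> ennreal (r * s) * (\<integral>\<^sup>+u. phi_pow (p u) (ennreal \<bar>f u / r\<bar>) + phi_pow (q u) (ennreal \<bar>g u / s\<bar>) \<partial>lebesgue_on \<Omega>)"
    proof (intro mult_left_mono nn_integral_mono_AE)
      show "AE u in lebesgue_on \<Omega>. ennreal \<bar>f u / r\<bar> * ennreal \<bar>g u / s\<bar>
          \<le> phi_pow (p u) (ennreal \<bar>f u / r\<bar>) + phi_pow (q u) (ennreal \<bar>g u / s\<bar>)"
        using pq AE_space
      proof eventually_elim
        case (elim u)
        then show ?case using p q by (intro phi_pow_Young) (auto simp: var_exponents_def)
      qed
    qed auto
    also have "\<dots> = ennreal (r * s) * (var_modular \<Omega> p (\<lambda>u. f u / r) + var_modular \<Omega> q (\<lambda>u. g u / s))"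
      unfolding var_modular_def using fm gm
      by (subst nn_integral_add) (auto intro!: borel_measurable_phi_pow pm qm)
    also have "\<dots> \<le> ennreal (r * s) * (1 + 1)"
      using r s by (intro mult_left_mono add_mono) auto
    also have "\<dots> = (2 * ennreal s) * ennreal r"
      using r s by (simp add: ennreal_mult ac_simps)
    finally show ?thesis .
  qed
  \<comment> \<open>Isolating \<open>e\<close> by division turns a bound for every admissible scale
    into a bound for the infimum of the scales.\<close>
  have div: "c / d \<le> e" if "c \<le> d * e" "0 < d" "d < \<infinity>" for c d e :: ennreal
    using that by (simp add: divide_le_posI_ennreal mult.commute)
  have mult: "c \<le> d * e" if "c / d \<le> e" "0 < d" "d < \<infinity>" for c d e :: ennreal
  proof -
    have "c = d * (c / d)"
      using that(2,3) by (simp add: ennreal_times_divide mult.commute ennreal_mult_divide_eq)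
    also have "\<dots> \<le> d * e" by (intro mult_left_mono that) auto
    finally show ?thesis .
  qed
  have "?I \<le> 2 * ennreal s * ennreal \<beta>" if s: "s \<in> ?S" for s
  proof -
    have "?I / (2 * ennreal s) \<le> Inf (ennreal ` ?R)"
      using *[OF _ s] s by (intro Inf_greatest) (auto intro!: div simp: ennreal_mult_less_top ennreal_zero_less_mult_iff)
    also have "\<dots> \<le> ennreal \<beta>"
      using f fL by (simp add: lux_norm_def)
    finally show ?thesis
      using s by (intro mult) (auto simp: ennreal_mult_less_top ennreal_zero_less_mult_iff)
  qed
  then have "?I / (2 * ennreal \<beta>) \<le> Inf (ennreal ` ?S)"
    using \<beta> by (intro Inf_greatest) (auto intro!: div simp: ennreal_mult_less_top ennreal_zero_less_mult_iff ac_simps)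
  then have "?I / (2 * ennreal \<beta>) \<le> lux_norm \<Omega> q g"
    using True by (simp add: lux_norm_def)
  then show ?thesis
    using \<beta> by (intro mult) (auto simp: ennreal_mult_less_top ennreal_zero_less_mult_iff)
qed

section \<open>Lattice cells\<close>

text \<open>The half-open cells are encoded as the level sets of one map with countable range. This
  makes them disjoint, and every function of the cell index is automatically measurable in
  \<open>s\<close>.\<close>

definition floor_vec :: "real^'n \<Rightarrow> int^'n" where
  "floor_vec s = (\<chi> i. \<lfloor>s $ i\<rfloor>)"

lemma floor_vec_translate: "s - lattice_pt (floor_vec s) \<in> cbox 0 1"
proof -
  have "s $ i - real_of_int \<lfloor>s $ i\<rfloor> \<le> 1" for i
    by linarith
  then show ?thesis
    by (simp add: mem_box_cart floor_vec_def lattice_pt_def)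
qed

lemma sets_floor_vec: "{s :: real^'n. floor_vec s = k} \<in> sets lebesgue"
proof -
  have "{s :: real^'n. floor_vec s = k} = (\<Inter>i. {s. real_of_int (k $ i) \<le> s $ i} \<inter> {s. s $ i < real_of_int (k $ i) + 1})"
    by (auto simp: floor_vec_def vec_eq_iff floor_eq_iff)
  moreover have "{s. real_of_int (k $ i) \<le> s $ i} \<inter> {s. s $ i < real_of_int (k $ i) + 1} \<in> sets (lebesgue :: (real^'n) measure)" for i
    by (intro sets.Int sets_completionI_sets borel_closed[THEN sets_lborel[THEN equalityD2, THEN subsetD]]
        borel_open[THEN sets_lborel[THEN equalityD2, THEN subsetD]]
        closed_halfspace_component_ge_cart open_halfspace_component_lt_cart)
  ultimately show ?thesis by (auto intro!: sets.countable_INT'')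
qed

lemma measurable_floor_vec: "floor_vec \<in> lebesgue \<rightarrow>\<^sub>M count_space (UNIV :: (int^'n) set)"
proof (subst measurable_count_space_eq_countable)
  show "countable (UNIV :: (int^'n) set)" by simp
  show "floor_vec \<in> space lebesgue \<rightarrow> UNIV \<and> (\<forall>k\<in>UNIV. floor_vec -` {k} \<inter> space lebesgue \<in> sets lebesgue)"
    using sets_floor_vec by (auto simp: vimage_def)
qed

lemma borel_measurable_floor_vec:
  fixes g :: "int^'n \<Rightarrow> 'b::topological_space"
  shows "(\<lambda>s. g (floor_vec s)) \<in> borel_measurable lebesgue"
  by (rule measurable_compose[OF measurable_floor_vec]) simp

section \<open>Sums over the lattice and integrals over its cells\<close>

lemma infsum_ennreal_eq_SUP:
  fixes f :: "'i \<Rightarrow> ennreal"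
  shows "infsum f UNIV = (SUP K\<in>{K. finite K}. sum f K)"
  using nonneg_infsum_complete[of UNIV f] by simp

lemma infsum_cmult_ennreal:
  fixes f :: "'i \<Rightarrow> ennreal"
  shows "(\<Sum>\<^sub>\<infinity>k\<in>UNIV. c * f k) = c * infsum f UNIV"
proof -
  have "{K :: 'i set. finite K} \<noteq> {}" by blast
  then show ?thesis
    unfolding infsum_ennreal_eq_SUP by (simp add: SUP_mult_left_ennreal flip: sum_distrib_left)
qed

lemma infsum_ennreal_of_real:
  assumes "(f has_sum s) UNIV" "\<And>k. 0 \<le> f k"
  shows "(\<Sum>\<^sub>\<infinity>k\<in>UNIV. ennreal (f k)) = ennreal s"
proof -
  have "ennreal s = (SUP K\<in>{K. finite K \<and> K \<subseteq> UNIV}. ennreal (sum f K))"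
    using infsum_nonneg_is_SUPREMUM_ennreal[of f UNIV] assms by (simp add: has_sum_imp_summable infsumI)
  then show ?thesis
    unfolding infsum_ennreal_eq_SUP using assms by (simp add: sum_ennreal)
qed

text \<open>Monotone convergence along an enumeration of the lattice: the integral over the first
  \<open>n\<close> cells is a finite sum, and over \<open>ennreal\<close> the infinite sum is the
  supremum of the finite ones.\<close>

lemma nn_integral_floor_vec_le:
  fixes f :: "real^'n \<Rightarrow> ennreal"
  assumes f: "f \<in> borel_measurable lebesgue"
  shows "(\<integral>\<^sup>+s. f s \<partial>lebesgue)
      \<le> (\<Sum>\<^sub>\<infinity>k\<in>UNIV. \<integral>\<^sup>+s. f s * indicator {s. floor_vec s = k} s \<partial>lebesgue)"
proof -
  define K :: "nat \<Rightarrow> (int^'n) set" where "K n = from_nat ` {..<n}" for n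
  have K: "finite (K n)" for n by (simp add: K_def)
  define g where "g n s = (f s * indicator (K n) (floor_vec s) :: ennreal)" for n and s :: "real^'n"
  have gm: "g n \<in> borel_measurable lebesgue" for n
    unfolding g_def by (intro borel_measurable_times_ennreal f borel_measurable_floor_vec)
  have "incseq K" unfolding K_def by (auto simp: incseq_def)
  then have inc: "incseq g"
    by (auto simp: incseq_def le_fun_def g_def intro!: mult_left_mono split: split_indicator)
  have SUP: "(SUP n. g n s) = f s" for s
  proof (rule SUP_eqI)
    fix n show "g n s \<le> f s" by (auto simp: g_def split: split_indicator)
  next
    fix y assume y: "\<And>n. n \<in> UNIV \<Longrightarrow> g n s \<le> y"
    \<comment> \<open>\<open>K n\<close> holds the lattice points with code strictly below
      \<open>n\<close>, hence the successor.\<close>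
    have "floor_vec s \<in> K (Suc (to_nat (floor_vec s)))"
      unfolding K_def by (rule image_eqI[of _ _ "to_nat (floor_vec s)"]) auto
    then have "f s = g (Suc (to_nat (floor_vec s))) s" by (simp add: g_def)
    then show "f s \<le> y" using y by simp
  qed
  have "(\<integral>\<^sup>+s. f s \<partial>lebesgue) = (\<integral>\<^sup>+s. (SUP n. g n s) \<partial>lebesgue)"
    by (simp add: SUP)
  also have "\<dots> = (SUP n. \<integral>\<^sup>+s. g n s \<partial>lebesgue)"
    by (rule nn_integral_monotone_convergence_SUP[OF inc gm])
  also have "\<dots> \<le> (\<Sum>\<^sub>\<infinity>k\<in>UNIV. \<integral>\<^sup>+s. f s * indicator {s. floor_vec s = k} s \<partial>lebesgue)"
  proof (rule SUP_least)
    fix n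
    have "g n s = (\<Sum>k\<in>K n. f s * indicator {s. floor_vec s = k} s)" for s
      using K[of n] by (simp add: g_def indicator_def sum.delta' flip: sum_distrib_left)
    then have "(\<integral>\<^sup>+s. g n s \<partial>lebesgue) = (\<integral>\<^sup>+s. (\<Sum>k\<in>K n. f s * indicator {s. floor_vec s = k} s) \<partial>lebesgue)"
      by simp
    also have "\<dots> = (\<Sum>k\<in>K n. \<integral>\<^sup>+s. f s * indicator {s. floor_vec s = k} s \<partial>lebesgue)"
      by (rule nn_integral_sum) (intro borel_measurable_times_ennreal f borel_measurable_indicator sets_floor_vec)
    also have "\<dots> \<le> (\<Sum>\<^sub>\<infinity>k\<in>UNIV. \<integral>\<^sup>+s. f s * indicator {s. floor_vec s = k} s \<partial>lebesgue)"
      unfolding infsum_ennreal_eq_SUP using K by (intro SUP_upper) auto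
    finally show "(\<integral>\<^sup>+s. g n s \<partial>lebesgue) \<le> (\<Sum>\<^sub>\<infinity>k\<in>UNIV. \<integral>\<^sup>+s. f s * indicator {s. floor_vec s = k} s \<partial>lebesgue)" .
  qed
  finally show ?thesis .
qed

text \<open>After translation by the lattice point the half-open cell lies in the closed unit cube,
  the domain of the Stepanov norms.\<close>

lemma nn_integral_cell_le:
  fixes f :: "real^'n \<Rightarrow> ennreal"
  assumes f: "f \<in> borel_measurable lebesgue"
  shows "(\<integral>\<^sup>+s. f s * indicator {s. floor_vec s = k} s \<partial>lebesgue)
      \<le> (\<integral>\<^sup>+\<sigma>. f (lattice_pt k + \<sigma>) \<partial>lebesgue_on (cbox 0 1))"
proof -
  have "(\<integral>\<^sup>+s. f s * indicator {s. floor_vec s = k} s \<partial>lebesgue)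
      = (\<integral>\<^sup>+\<sigma>. f (lattice_pt k + \<sigma>) * indicator {s. floor_vec s = k} (lattice_pt k + \<sigma>) \<partial>lebesgue)"
    by (rule nn_integral_lebesgue_translate[symmetric])
       (intro borel_measurable_times_ennreal f borel_measurable_indicator sets_floor_vec)
  also have "\<dots> \<le> (\<integral>\<^sup>+\<sigma>. f (lattice_pt k + \<sigma>) * indicator (cbox 0 1) \<sigma> \<partial>lebesgue)"
  proof (rule nn_integral_mono)
    fix \<sigma> :: "real^'n"
    show "f (lattice_pt k + \<sigma>) * indicator {s. floor_vec s = k} (lattice_pt k + \<sigma>)
        \<le> f (lattice_pt k + \<sigma>) * indicator (cbox 0 1) \<sigma>"
      using floor_vec_translate[of "lattice_pt k + \<sigma>"] by (auto split: split_indicator)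
  qed
  also have "\<dots> = (\<integral>\<^sup>+\<sigma>. f (lattice_pt k + \<sigma>) \<partial>lebesgue_on (cbox 0 1))"
    by (subst nn_integral_restrict_space) auto
  finally show ?thesis .
qed

lemma emeasure_unit_cbox: "emeasure lebesgue (cbox 0 1 :: (real^'n) set) = 1"
proof -
  have "emeasure lebesgue (cbox 0 1 :: (real^'n) set) = ennreal (measure lebesgue (cbox 0 1 :: (real^'n) set))"
    by (intro emeasure_eq_measure2 lmeasurable_cbox)
  also have "measure lebesgue (cbox 0 1 :: (real^'n) set) = 1"
    using content_cbox_cart[of 0 "1 :: real^'n"] interval_ne_empty_cart(1)[of 0 "1 :: real^'n"] by simp
  finally show ?thesis by simp
qed

text \<open>The step function with value \<open>a k\<close> on the cell of \<open>k\<close> is the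
  density for Jensen's inequality; its mass is bounded by the sum of the weights because a cell has
  volume at most 1.\<close>

lemma nn_integral_floor_vec_weight_le:
  fixes a :: "int^'n \<Rightarrow> real"
  assumes a: "\<And>k. 0 \<le> a k" "(a has_sum s) UNIV"
  shows "(\<integral>\<^sup>+s. ennreal (a (floor_vec s)) \<partial>lebesgue) \<le> ennreal s"
proof -
  have "(\<integral>\<^sup>+s. ennreal (a (floor_vec s)) \<partial>lebesgue)
      \<le> (\<Sum>\<^sub>\<infinity>k\<in>UNIV. \<integral>\<^sup>+s. ennreal (a (floor_vec s)) * indicator {s. floor_vec s = k} s \<partial>lebesgue)"
    by (rule nn_integral_floor_vec_le) (rule borel_measurable_floor_vec)
  also have "\<dots> \<le> (\<Sum>\<^sub>\<infinity>k\<in>UNIV. ennreal (a k))"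
  proof (intro infsum_mono nonneg_summable_on_complete)
    fix k
    have "(\<integral>\<^sup>+s. ennreal (a (floor_vec s)) * indicator {s. floor_vec s = k} s \<partial>lebesgue)
        = (\<integral>\<^sup>+s. ennreal (a k) * indicator {s. floor_vec s = k} s \<partial>lebesgue)"
      by (intro nn_integral_cong) (auto split: split_indicator)
    also have "\<dots> \<le> (\<integral>\<^sup>+\<sigma>. ennreal (a k) \<partial>lebesgue_on (cbox 0 1 :: (real^'n) set))"
      by (rule nn_integral_cell_le) simp
    also have "\<dots> = ennreal (a k)"
      by (simp add: emeasure_restrict_space emeasure_unit_cbox del: emeasure_completion)
    finally show "(\<integral>\<^sup>+s. ennreal (a (floor_vec s)) * indicator {s. floor_vec s = k} s \<partial>lebesgue) \<le> ennreal (a k)" .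
  qed auto
  also have "\<dots> = ennreal s" by (rule infsum_ennreal_of_real[OF a(2,1)])
  finally show ?thesis .
qed

lemma norm_le_CARD_of_unit_cbox:
  fixes u :: "real^'n"
  assumes "u \<in> cbox 0 1"
  shows "norm u \<le> real CARD('n)"
proof -
  have "norm u \<le> (\<Sum>i\<in>UNIV. \<bar>u $ i\<bar>)" by (rule norm_le_l1_cart)
  also have "\<dots> \<le> (\<Sum>i\<in>(UNIV :: 'n set). 1)"
    using assms by (intro sum_mono) (auto simp: mem_box_cart)
  finally show ?thesis by simp
qed

text \<open>The diagonal points with all coordinates equal to a large \<open>n\<close> already
  qualify. This supplies the infinitely many terms that make the kernel sum diverge when
  \<open>\<phi> 0 > 0\<close>.\<close>

lemma infinite_lattice_pt_far: "infinite {k :: int^'n. M \<le> norm (v + lattice_pt k) \<and> M \<le> norm (v + lattice_pt k + \<tau>)}"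
  (is "infinite ?K")
proof
  assume fin: "finite ?K"
  define R where "R = \<bar>M\<bar> + norm v + norm \<tau>"
  have "infinite {n :: nat. R \<le> real n}"
    using real_arch_simple[of R] by (metis (mono_tags, lifting) infinite_nat_iff_unbounded_le mem_Collect_eq nat_le_linear of_nat_mono order_trans)
  moreover have "inj_on (\<lambda>n :: nat. (\<chi> i. int n) :: int^'n) {n. R \<le> real n}"
    by (auto simp: inj_on_def vec_eq_iff)
  ultimately have "infinite ((\<lambda>n :: nat. (\<chi> i. int n) :: int^'n) ` {n. R \<le> real n})"
    by (simp add: finite_image_iff)
  moreover have "(\<lambda>n :: nat. (\<chi> i. int n) :: int^'n) ` {n. R \<le> real n} \<subseteq> ?K"
  proof safe
    fix n :: nat assume n: "R \<le> real n"
    let ?k = "(\<chi> i. int n) :: int^'n"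
    have "real n \<le> norm (lattice_pt ?k)"
      using component_le_norm_cart[of "lattice_pt ?k"] by (simp add: lattice_pt_def)
    moreover have "norm (lattice_pt ?k) \<le> norm (v + lattice_pt ?k) + norm v"
      using norm_triangle_ineq4[of "v + lattice_pt ?k" v] by simp
    moreover have "norm (lattice_pt ?k) \<le> norm (v + lattice_pt ?k + \<tau>) + (norm v + norm \<tau>)"
      using norm_triangle_ineq4[of "v + lattice_pt ?k + \<tau>" "v + \<tau>"] norm_triangle_ineq[of v \<tau>]
      by (simp add: algebra_simps)
    ultimately show "M \<le> norm (v + lattice_pt ?k)" "M \<le> norm (v + lattice_pt ?k + \<tau>)"
      using n norm_ge_zero[of \<tau>] norm_ge_zero[of v] unfolding R_def by linarith+
  qed
  ultimately show False using fin finite_subset by blast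
qed

section \<open>Jensen's inequality and tails of integrable functions\<close>

text \<open>Nothing is known about \<open>\<phi>\<close> on negative numbers; composing it with
  \<open>max 0\<close> gives a function monotone on the whole line that agrees on the values of
  \<open>f\<close>.\<close>

lemma borel_measurable_mono_on_nonneg:
  fixes \<phi> :: "real \<Rightarrow> real"
  assumes \<phi>: "mono_on {0..} \<phi>" and f: "f \<in> borel_measurable M" "\<And>x. 0 \<le> f x"
  shows "(\<lambda>x. \<phi> (f x)) \<in> borel_measurable M"
proof -
  have "mono (\<lambda>y. \<phi> (max 0 y))"
    using \<phi> by (auto intro!: monoI simp: mono_on_def)
  then have "(\<lambda>x. \<phi> (max 0 (f x))) \<in> borel_measurable M"
    using measurable_compose[OF f(1) borel_measurable_mono] by blast
  then show ?thesis using f(2) by (simp add: max_def)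
qed

lemma convex_on_supporting_slope:
  fixes \<phi> :: "real \<Rightarrow> real"
  assumes "convex_on {0..} \<phi>" "0 < m"
  obtains s where "\<And>y. 0 \<le> y \<Longrightarrow> \<phi> m + s * (y - m) \<le> \<phi> y"
  using convex_le_Inf_differential[OF assms(1), of m] assms(2)
  by (metis atLeast_iff greaterThan_iff interior_real_atLeast)

text \<open>Jensen's inequality for the measure with density \<open>w\<close>, by integrating a supporting line of
  \<open>\<phi>\<close> at \<open>m\<close>; the total mass may be less than 1 because \<open>\<phi>\<close> vanishes at 0.\<close>

lemma Jensen_density:
  fixes \<phi> :: "real \<Rightarrow> real"
  assumes \<phi>: "convex_on {0..} \<phi>" "mono_on {0..} \<phi>" "\<phi> 0 = 0"
    and w: "w \<in> borel_measurable M" "\<And>x. 0 < w x" "(\<integral>\<^sup>+x. ennreal (w x) \<partial>M) \<le> 1"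
    and G: "G \<in> borel_measurable M" "\<And>x. 0 \<le> G x"
    and m: "(\<integral>\<^sup>+x. ennreal (G x) \<partial>M) = ennreal m" "0 \<le> m"
  shows "ennreal (\<phi> m) \<le> (\<integral>\<^sup>+x. ennreal (w x * \<phi> (G x / w x)) \<partial>M)" (is "_ \<le> ?\<Phi>")
proof (cases "m = 0 \<or> ?\<Phi> = \<infinity>")
  case False
  then have m0: "0 < m" using m(2) by auto
  have pos: "0 \<le> \<phi> y" if "0 \<le> y" for y
    using \<phi>(2,3) that by (metis atLeast_iff mono_onD order_refl)
  obtain s where s: "\<And>y. 0 \<le> y \<Longrightarrow> \<phi> m + s * (y - m) \<le> \<phi> y"
    using convex_on_supporting_slope[OF \<phi>(1) m0] by blast
  \<comment> \<open>The supporting line at the origin lies below \<open>\<phi> 0 = 0\<close>. This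
    fixes the sign of the slope and later compensates for a total mass below 1.\<close>
  have sm: "\<phi> m \<le> s * m" using s[of 0] \<phi>(3) by (simp add: algebra_simps)
  then have "0 \<le> s * m" using pos[OF m(2)] by linarith
  then have s0: "0 \<le> s" using m0 by (simp add: zero_le_mult_iff)
  obtain I where I: "(\<integral>\<^sup>+x. ennreal (w x) \<partial>M) = ennreal I" "0 \<le> I" "I \<le> 1"
    using w(3) by (cases "\<integral>\<^sup>+x. ennreal (w x) \<partial>M") auto
  obtain P where P: "?\<Phi> = ennreal P" "0 \<le> P"
    using False by (cases ?\<Phi>) auto
  have \<phi>m: "(\<lambda>x. \<phi> (G x / w x)) \<in> borel_measurable M"
    by (rule borel_measurable_mono_on_nonneg[OF \<phi>(2)])
       (use G w in \<open>auto intro: divide_nonneg_pos\<close>)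
  have "ennreal (\<phi> m * I + s * m) = ennreal (\<phi> m) * (\<integral>\<^sup>+x. ennreal (w x) \<partial>M) + ennreal s * (\<integral>\<^sup>+x. ennreal (G x) \<partial>M)"
    using pos[OF m(2)] s0 m I by (simp add: ennreal_mult ennreal_plus)
  also have "\<dots> = (\<integral>\<^sup>+x. ennreal (\<phi> m) * ennreal (w x) + ennreal s * ennreal (G x) \<partial>M)"
    using w(1) G(1) by (simp add: nn_integral_add nn_integral_cmult)
  also have "\<dots> \<le> (\<integral>\<^sup>+x. ennreal (w x * \<phi> (G x / w x)) + ennreal (s * m) * ennreal (w x) \<partial>M)"
  proof (rule nn_integral_mono)
    fix x
    have "0 \<le> G x / w x" using G(2)[of x] w(2)[of x] by simp
    then have "w x * (\<phi> m + s * (G x / w x - m)) \<le> w x * \<phi> (G x / w x)"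
      using w(2)[of x] by (intro mult_left_mono s) auto
    also have "w x * (\<phi> m + s * (G x / w x - m)) = \<phi> m * w x + s * G x - s * m * w x"
      using w(2)[of x] by (simp add: field_simps)
    finally have "\<phi> m * w x + s * G x \<le> w x * \<phi> (G x / w x) + s * m * w x" by simp
    then show "ennreal (\<phi> m) * ennreal (w x) + ennreal s * ennreal (G x)
        \<le> ennreal (w x * \<phi> (G x / w x)) + ennreal (s * m) * ennreal (w x)"
      using pos[OF m(2)] pos[OF \<open>0 \<le> G x / w x\<close>] s0 m0 w(2)[of x] G(2)[of x]
      by (simp add: ennreal_leI flip: ennreal_mult ennreal_plus)
  qed
  also have "\<dots> = ?\<Phi> + ennreal (s * m) * (\<integral>\<^sup>+x. ennreal (w x) \<partial>M)"
    using w(1) \<phi>m by (simp add: nn_integral_add nn_integral_cmult)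
  also have "\<dots> = ennreal (P + s * m * I)"
    using P I s0 m0 by (simp add: ennreal_mult ennreal_plus)
  finally have "\<phi> m * I + s * m \<le> P + s * m * I"
    using P I s0 m0 by (subst (asm) ennreal_le_iff) auto
  \<comment> \<open>Integrating the line gives
    \<open>P \<ge> \<phi> m * I + s * m * (1 - I)\<close>. By \<open>sm\<close> the last summand is
    at least \<open>\<phi> m * (1 - I)\<close>, which restores the missing mass.\<close>
  moreover have "0 \<le> (s * m - \<phi> m) * (1 - I)" using sm I by simp
  ultimately have "\<phi> m \<le> P" by (simp add: algebra_simps)
  then show ?thesis using P by (simp add: ennreal_leI)
qed (use \<phi> in auto)

lemma integrable_tail:
  fixes h :: "real^'n \<Rightarrow> complex"
  assumes h: "integrable lebesgue h" and e: "0 < e"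
  obtains r where "(\<integral>\<^sup>+y. ennreal (norm (h y)) * indicator {y. r \<le> norm y} y \<partial>lebesgue) \<le> ennreal e"
proof -
  have hm: "h \<in> borel_measurable lebesgue" using h by auto
  have r: "{y :: real^'n. r \<le> norm y} \<in> sets lebesgue" for r
    by (intro sets_completionI_sets) auto
  have "(\<lambda>n. \<integral>\<^sup>+y. ennreal (norm (h y)) * indicator {y. real n \<le> norm y} y \<partial>lebesgue)
      \<longlonglongrightarrow> (\<integral>\<^sup>+y. 0 \<partial>(lebesgue :: (real^'n) measure))"
  proof (rule nn_integral_dominated_convergence[where w = "\<lambda>y. ennreal (norm (h y))"])
    show "(\<lambda>y. ennreal (norm (h y)) * indicator {y. real n \<le> norm y} y) \<in> borel_measurable lebesgue" for n
      using hm r by (intro borel_measurable_times_ennreal borel_measurable_indicator) auto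
    show "(\<integral>\<^sup>+y. ennreal (norm (h y)) \<partial>lebesgue) < \<infinity>"
      using h by (simp add: integrable_iff_bounded)
    show "AE y in lebesgue. (\<lambda>n. ennreal (norm (h y)) * indicator {y. real n \<le> norm y} y) \<longlonglongrightarrow> 0"
    proof (rule AE_I2)
      fix y :: "real^'n"
      obtain N where N: "norm y < real N" using reals_Archimedean2 by blast
      have "\<forall>\<^sub>F n in sequentially. ennreal (norm (h y)) * indicator {y. real n \<le> norm y} y = 0"
        using eventually_ge_at_top[of N] by eventually_elim (use N in auto)
      then show "(\<lambda>n. ennreal (norm (h y)) * indicator {y. real n \<le> norm y} y) \<longlonglongrightarrow> 0"
        by (rule tendsto_eventually)
    qed
  qed (use hm in \<open>auto split: split_indicator\<close>)
  then have "\<forall>\<^sub>F n in sequentially. (\<integral>\<^sup>+y. ennreal (norm (h y)) * indicator {y. real n \<le> norm y} y \<partial>lebesgue) < ennreal e"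
    using e by (intro order_tendstoD(2)) auto
  then obtain n where "(\<integral>\<^sup>+y. ennreal (norm (h y)) * indicator {y. real n \<le> norm y} y \<partial>lebesgue) < ennreal e"
    by (auto simp: eventually_sequentially)
  then show ?thesis using that[of "real n"] by simp
qed

section \<open>The kernel sum\<close>

text \<open>Only the data common to both notions are fixed. The function \<open>F\<close>, the
  weights, \<open>\<tau>\<close> and the tolerances stay variable, so that one estimate serves
  almost periodicity and uniform recurrence.\<close>

locale convolution_kernel =
  fixes p q :: "real^'n \<Rightarrow> ennreal" and \<phi> \<psi> :: "real \<Rightarrow> real" and a :: "int^'n \<Rightarrow> real"
    and h :: "real^'n \<Rightarrow> complex"
  assumes p: "p \<in> var_exponents (cbox 0 1)" and q: "q \<in> var_exponents (cbox 0 1)"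
    and conjugate: "AE u in lebesgue_on (cbox 0 1). inverse (p u) + inverse (q u) = 1"
    and \<phi>_nonneg: "\<And>y. 0 \<le> y \<Longrightarrow> 0 \<le> \<phi> y" and \<phi>_convex: "convex_on {0..} \<phi>"
    and \<phi>_strict_mono: "strict_mono_on {0..} \<phi>"
    and \<psi>_nonneg: "\<And>y. 0 \<le> y \<Longrightarrow> 0 \<le> \<psi> y"
    and \<phi>_mult_le: "\<And>x y. 0 \<le> x \<Longrightarrow> 0 \<le> y \<Longrightarrow> \<phi> (x * y) \<le> \<psi> x * \<phi> y"
    and h: "integrable lebesgue h"
    and a_pos: "\<And>k. 0 < a k" and a_sum: "(a has_sum 1) UNIV"
begin

definition kernel_term :: "(real^'n \<Rightarrow> real) \<Rightarrow> real^'n \<Rightarrow> real^'n \<Rightarrow> int^'n \<Rightarrow> ennreal" where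
  "kernel_term w t u k = ennreal (a k * \<psi> (inverse (a k))) *
     lux_norm (cbox 0 1) q (\<lambda>\<sigma>. \<psi> (cmod (h (t - \<sigma> - lattice_pt k)))) / ennreal (w (u + lattice_pt k))"

definition kernel_sum :: "(real^'n \<Rightarrow> real) \<Rightarrow> real^'n \<Rightarrow> real^'n \<Rightarrow> ennreal" where
  "kernel_sum w t u = infsum (kernel_term w t u) UNIV"

lemma \<phi>_mono_on: "mono_on {0..} \<phi>"
  using \<phi>_strict_mono by (rule strict_mono_on_imp_mono_on)

lemma \<phi>_mono: "0 \<le> y \<Longrightarrow> y \<le> z \<Longrightarrow> \<phi> y \<le> \<phi> z"
  using \<phi>_mono_on by (auto simp: mono_on_def)

lemma \<phi>_0_less_1: "\<phi> 0 < \<phi> 1"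
  using \<phi>_strict_mono by (auto simp: strict_mono_on_def)

lemma \<phi>_1_pos: "0 < \<phi> 1"
  using \<phi>_0_less_1 \<phi>_nonneg[of 0] by simp

text \<open>Positivity makes \<open>\<psi> 2\<close> times an infinite kernel sum infinite and
  allows division by \<open>\<psi> 2\<close> in the choice of the near bound.\<close>

lemma \<psi>_2_pos: "0 < \<psi> 2"
proof -
  have "0 < \<phi> 2" using \<phi>_1_pos \<phi>_mono[of 1 2] by simp
  also have "\<phi> 2 \<le> \<psi> 2 * \<phi> 1" using \<phi>_mult_le[of 2 1] by simp
  finally show ?thesis using \<phi>_1_pos by (simp add: zero_less_mult_iff)
qed

lemma a_le_1: "a k \<le> 1"
  using finite_sum_le_has_sum[OF a_sum, of "{k}"] a_pos by (simp add: less_imp_le)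

lemma \<phi>_convex_0: "0 \<le> r \<Longrightarrow> r \<le> 1 \<Longrightarrow> 0 \<le> y \<Longrightarrow> \<phi> (r * y) \<le> r * \<phi> y + (1 - r) * \<phi> 0"
  using convex_onD[OF \<phi>_convex, of r 0 y] by (simp add: add.commute)

text \<open>Convexity between 0 and \<open>inverse (a k)\<close>, evaluated at 1, is combined with
  \<open>\<phi> (inverse (a k)) \<le> \<psi> (inverse (a k)) * \<phi> 1\<close>. The bound is
  independent of \<open>k\<close> although \<open>a k\<close> tends to 0.\<close>

lemma kernel_coeff_ge: "(\<phi> 1 - \<phi> 0) / \<phi> 1 \<le> a k * \<psi> (inverse (a k))"
proof -
  have "\<phi> 1 \<le> a k * \<phi> (inverse (a k)) + (1 - a k) * \<phi> 0"
    using \<phi>_convex_0[of "a k" "inverse (a k)"] a_pos[of k] a_le_1[of k] by simp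
  also have "\<phi> (inverse (a k)) \<le> \<psi> (inverse (a k)) * \<phi> 1"
    using \<phi>_mult_le[of "inverse (a k)" 1] a_pos[of k] by simp
  also have "(1 - a k) * \<phi> 0 \<le> 1 * \<phi> 0"
    using a_pos[of k] \<phi>_nonneg[of 0] by (intro mult_right_mono) auto
  finally have "\<phi> 1 - \<phi> 0 \<le> a k * (\<psi> (inverse (a k)) * \<phi> 1)"
    using a_pos[of k] by simp
  then show ?thesis
    using \<phi>_1_pos by (simp add: divide_le_eq mult.assoc)
qed

lemma kernel_coeff_pos: "0 < a k * \<psi> (inverse (a k))"
  using kernel_coeff_ge[of k] \<phi>_0_less_1 \<phi>_1_pos by (smt (verit) divide_pos_pos)

lemma unit_cbox_sets: "(cbox 0 1 :: (real^'n) set) \<in> sets lebesgue" "1 \<le> emeasure lebesgue (cbox 0 1 :: (real^'n) set)"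
  by (simp, simp only: emeasure_unit_cbox order_refl)

text \<open>If \<open>\<phi> 0 > 0\<close>, then all Stepanov norms are at least \<open>\<phi> 0\<close> and \<open>\<psi> \<ge> 1\<close>, so that the terms
  of the kernel sum do not tend to 0.\<close>

lemma kernel_sum_infinite:
  assumes \<phi>0: "0 < \<phi> 0" and w: "\<And>s. 0 < w s" and \<beta>: "0 < \<beta>"
    and far: "\<And>s. M \<le> norm s \<Longrightarrow> M \<le> norm (s + \<tau>) \<Longrightarrow> stepanov_diff (cbox 0 1) p \<phi> c F \<tau> s x \<le> ennreal (\<beta> / w s)"
  shows "kernel_sum w t u = \<infinity>"
proof -
  let ?K = "{k. M \<le> norm (u + lattice_pt k) \<and> M \<le> norm (u + lattice_pt k + \<tau>)}"
  define b where "b = (\<phi> 1 - \<phi> 0) / \<phi> 1 * (\<phi> 0 / \<beta>)"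
  have b: "0 < b" using \<phi>0 \<beta> \<phi>_0_less_1 \<phi>_1_pos by (simp add: b_def)
  have \<psi>1: "1 \<le> \<psi> y" if "0 \<le> y" for y
    using \<phi>_mult_le[OF that, of 0] \<phi>0 by simp
  have "ennreal b \<le> kernel_term w t u k" if k: "k \<in> ?K" for k
  proof -
    let ?w = "w (u + lattice_pt k)"
    \<comment> \<open>A Stepanov norm that is both at least \<open>\<phi> 0\<close> and at most
      \<open>\<beta> / w\<close> keeps \<open>1 / w\<close> above \<open>\<phi> 0 / \<beta>\<close>
      at every far point; this is the second factor of \<open>b\<close>.\<close>
    have "ennreal (\<phi> 0) \<le> stepanov_diff (cbox 0 1) p \<phi> c F \<tau> (u + lattice_pt k) x"
      unfolding stepanov_diff_def using \<phi>_nonneg \<phi>_mono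
      by (intro lux_norm_ge[OF p unit_cbox_sets \<phi>0]) auto
    also have "\<dots> \<le> ennreal (\<beta> / ?w)" using k by (intro far) auto
    finally have "\<phi> 0 \<le> \<beta> / ?w"
      using \<beta> w[of "u + lattice_pt k"] by (subst (asm) ennreal_le_iff) auto
    then have "\<phi> 0 / \<beta> \<le> 1 / ?w"
      using \<beta> w[of "u + lattice_pt k"] by (simp add: field_simps)
    then have "b \<le> a k * \<psi> (inverse (a k)) * (1 / ?w)"
      unfolding b_def using kernel_coeff_ge[of k] kernel_coeff_pos[of k] \<phi>0 \<beta>
      by (intro mult_mono) auto
    then have "ennreal b \<le> ennreal (a k * \<psi> (inverse (a k)) * (1 / ?w))"
      by (rule ennreal_leI)
    also have "\<dots> = ennreal (a k * \<psi> (inverse (a k))) * ennreal 1 / ennreal ?w"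
      using kernel_coeff_pos[of k] w[of "u + lattice_pt k"] by (simp add: divide_ennreal)
    also have "\<dots> \<le> kernel_term w t u k"
      unfolding kernel_term_def
      by (intro divide_right_mono_ennreal mult_left_mono lux_norm_ge[OF q unit_cbox_sets])
         (auto intro: order_trans[OF \<psi>1 abs_ge_self])
    finally show ?thesis .
  qed
  then have "infsum (kernel_term w t u) ?K = \<infinity>"
    using b infinite_lattice_pt_far by (intro infsum_superconst_infinite_ennreal[of _ "ennreal b"]) auto
  moreover have "infsum (kernel_term w t u) ?K \<le> kernel_sum w t u"
    unfolding kernel_sum_def by (rule infsum_mono_neutral) (auto intro: nonneg_summable_on_complete)
  ultimately show ?thesis by (simp add: top_unique)
qed

text \<open>Submultiplicativity is used twice: once to extract
  \<open>\<psi> (inverse (a k))\<close>, once to separate \<open>\<psi>\<close> of the kernel from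
  \<open>\<phi>\<close> of the difference \<open>D\<close>. Hoelder's inequality then pairs
  \<open>D\<close> in the exponent \<open>p\<close> with the kernel in the exponent
  \<open>q\<close>; its constant is the 2 in the conclusion.\<close>

lemma nn_integral_far_cell_le:
  assumes \<phi>0: "\<phi> 0 = 0" and \<beta>: "0 < \<beta>" and w: "0 < w (u + lattice_pt k)"
    and D: "\<And>s. 0 \<le> D s"
    and bound: "lux_norm (cbox 0 1) p (\<lambda>\<sigma>. \<phi> (D (\<sigma> + (u + lattice_pt k)))) \<le> ennreal (\<beta> / w (u + lattice_pt k))"
    and G: "G \<in> borel_measurable lebesgue" "\<And>s. G s = cmod (h (t - s)) * D (u + s)"
  shows "(\<integral>\<^sup>+s. ennreal (a k * \<phi> (G s / a k)) * indicator {s. floor_vec s = k} s \<partial>lebesgue)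
      \<le> ennreal (2 * \<beta>) * kernel_term w t u k"
proof -
  let ?A = "ennreal (a k * \<psi> (inverse (a k)))" and ?w = "w (u + lattice_pt k)"
  let ?L = "lux_norm (cbox 0 1) q (\<lambda>\<sigma>. \<psi> (cmod (h (t - \<sigma> - lattice_pt k))))"
  have G0: "0 \<le> G s" for s by (simp add: G(2) D)
  have \<phi>G: "(\<lambda>s. ennreal (\<phi> (G s))) \<in> borel_measurable lebesgue"
    by (intro measurable_compose[OF _ measurable_ennreal]) (rule borel_measurable_mono_on_nonneg[OF \<phi>_mono_on G(1) G0])
  have "(\<integral>\<^sup>+s. ennreal (a k * \<phi> (G s / a k)) * indicator {s. floor_vec s = k} s \<partial>lebesgue)
      \<le> (\<integral>\<^sup>+s. ?A * (ennreal (\<phi> (G s)) * indicator {s. floor_vec s = k} s) \<partial>lebesgue)"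
  proof (rule nn_integral_mono)
    fix s
    have "a k * \<phi> (G s / a k) \<le> a k * (\<psi> (inverse (a k)) * \<phi> (G s))"
      using \<phi>_mult_le[of "inverse (a k)" "G s"] a_pos[of k] G0[of s]
      by (intro mult_left_mono) (auto simp: field_simps)
    then have "ennreal (a k * \<phi> (G s / a k)) \<le> ?A * ennreal (\<phi> (G s))"
      using kernel_coeff_pos[of k] \<phi>_nonneg[OF G0[of s]]
      by (simp add: ennreal_leI mult.assoc flip: ennreal_mult)
    then show "ennreal (a k * \<phi> (G s / a k)) * indicator {s. floor_vec s = k} s
        \<le> ?A * (ennreal (\<phi> (G s)) * indicator {s. floor_vec s = k} s)"
      by (auto split: split_indicator)
  qed
  also have "\<dots> = ?A * (\<integral>\<^sup>+s. ennreal (\<phi> (G s)) * indicator {s. floor_vec s = k} s \<partial>lebesgue)"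
    by (rule nn_integral_cmult) (intro borel_measurable_times_ennreal \<phi>G borel_measurable_indicator sets_floor_vec)
  also have "\<dots> \<le> ?A * (\<integral>\<^sup>+\<sigma>. ennreal (\<phi> (G (lattice_pt k + \<sigma>))) \<partial>lebesgue_on (cbox 0 1))"
    by (intro mult_left_mono nn_integral_cell_le \<phi>G) auto
  also have "\<dots> \<le> ?A * (\<integral>\<^sup>+\<sigma>. ennreal \<bar>\<phi> (D (\<sigma> + (u + lattice_pt k)))\<bar> * ennreal \<bar>\<psi> (cmod (h (t - \<sigma> - lattice_pt k)))\<bar> \<partial>lebesgue_on (cbox 0 1))"
  proof (intro mult_left_mono nn_integral_mono)
    fix \<sigma> :: "real^'n"
    have *: "t - (lattice_pt k + \<sigma>) = t - \<sigma> - lattice_pt k" "u + (lattice_pt k + \<sigma>) = \<sigma> + (u + lattice_pt k)"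
      by (simp_all add: algebra_simps)
    have "\<phi> (G (lattice_pt k + \<sigma>)) \<le> \<psi> (cmod (h (t - \<sigma> - lattice_pt k))) * \<phi> (D (\<sigma> + (u + lattice_pt k)))"
      unfolding G(2) * by (intro \<phi>_mult_le D) simp
    then show "ennreal (\<phi> (G (lattice_pt k + \<sigma>)))
        \<le> ennreal \<bar>\<phi> (D (\<sigma> + (u + lattice_pt k)))\<bar> * ennreal \<bar>\<psi> (cmod (h (t - \<sigma> - lattice_pt k)))\<bar>"
      using \<phi>_nonneg[OF D] \<psi>_nonneg by (simp add: ennreal_leI mult.commute flip: ennreal_mult)
  qed simp
  also have "\<dots> \<le> ?A * (2 * ennreal (\<beta> / ?w) * ?L)"
    using \<beta> w by (intro mult_left_mono lux_norm_Hoelder[OF p q conjugate bound]) auto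
  also have "\<dots> = ennreal (2 * \<beta>) * kernel_term w t u k"
    using \<beta> w by (simp add: kernel_term_def divide_ennreal_def ennreal_mult ac_simps flip: divide_ennreal)
  finally show ?thesis .
qed

end

section \<open>The convolution estimate\<close>

lemma ennreal_mult_le_iff_le_divide:
  assumes "0 < w" "0 \<le> \<beta>"
  shows "ennreal w * d \<le> ennreal \<beta> \<longleftrightarrow> d \<le> ennreal (\<beta> / w)"
  using assms by (cases d) (auto simp: ennreal_mult_top top_unique le_divide_eq mult.commute ennreal_le_iff simp flip: ennreal_mult)

text \<open>The substitution \<open>\<sigma> = t - s\<close> removes \<open>t\<close> from the
  arguments of \<open>F\<close> and \<open>u\<close> from that of \<open>h\<close>.\<close>

lemma norm_conv_diff:
  fixes F :: "real^'n \<Rightarrow> 'x \<Rightarrow> 'y::complex_banach" and h :: "real^'n \<Rightarrow> complex"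
    and t u \<tau> :: "real^'n" and c :: complex
  assumes conv: "\<And>t. bochner_integrable lebesgue (\<lambda>\<sigma>. h \<sigma> *\<^sub>C F (t - \<sigma>) x)"
  defines "G \<equiv> \<lambda>s. cmod (h (t - s)) * norm (F (u + s + \<tau>) x - c *\<^sub>C F (u + s) x)"
  shows borel_measurable_conv_diff: "G \<in> borel_measurable lebesgue"
    and norm_conv_diff_le:
      "ennreal (norm (conv h F (u + t + \<tau>) x - c *\<^sub>C conv h F (u + t) x)) \<le> (\<integral>\<^sup>+s. ennreal (G s) \<partial>lebesgue)"
proof -
  define H where "H \<sigma> = cmod (h \<sigma>) * norm (F (u + t + \<tau> - \<sigma>) x - c *\<^sub>C F (u + t - \<sigma>) x)" for \<sigma>
  have H: "norm (h \<sigma> *\<^sub>C F (u + t + \<tau> - \<sigma>) x - c *\<^sub>C h \<sigma> *\<^sub>C F (u + t - \<sigma>) x) = H \<sigma>" for \<sigma>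
    by (simp add: H_def scaleC_scaleC mult.commute[of c] scaleC_diff_right flip: norm_scaleC)
  note B = has_bochner_conv[of h F "u + t + \<tau>" x, OF conv] has_bochner_conv[of h F "u + t" x, OF conv]
  note diff = has_bochner_diff_scaleC[OF completion.complete_measure_axioms B, of c, unfolded H]
  have G: "G = (\<lambda>s. H (t - s))"
    by (simp add: G_def H_def algebra_simps)
  show "G \<in> borel_measurable lebesgue"
    unfolding G by (rule measurable_compose[OF lebesgue_reflect_measurable diff(1)])
  have "(\<integral>\<^sup>+s. ennreal (G s) \<partial>lebesgue) = (\<integral>\<^sup>+s. ennreal (H s) \<partial>lebesgue)"
    unfolding G by (rule nn_integral_lebesgue_reflect[OF measurable_compose[OF diff(1) measurable_ennreal]])
  then show "ennreal (norm (conv h F (u + t + \<tau>) x - c *\<^sub>C conv h F (u + t) x)) \<le> (\<integral>\<^sup>+s. ennreal (G s) \<partial>lebesgue)"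
    using diff(2) by simp
qed

context convolution_kernel
begin

text \<open>This is the estimate at a single \<open>u\<close>. Far and near parts have masses
  \<open>A\<close> and \<open>B\<close>; convexity at their midpoint gives each the factor
  \<open>\<psi> 2 / 2\<close>. For \<open>A\<close> it meets \<open>2 * \<beta>\<close> from the far
  cells, for \<open>B\<close> it meets the condition on \<open>b\<close>, leaving
  \<open>\<beta> * \<gamma>\<close>.\<close>

lemma \<phi>_conv_diff_le:
  fixes F :: "real^'n \<Rightarrow> 'x \<Rightarrow> 'y::complex_banach"
  assumes conv: "\<And>t. bochner_integrable lebesgue (\<lambda>\<sigma>. h \<sigma> *\<^sub>C F (t - \<sigma>) x)"
    and C: "\<And>s. norm (F s x) \<le> C"
    and \<beta>: "0 < \<beta>" and \<gamma>: "0 \<le> \<gamma>" and w: "\<And>s. 0 < w s" and u: "u \<in> cbox 0 1"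
    and far: "\<And>s. M \<le> norm s \<Longrightarrow> M \<le> norm (s + \<tau>) \<Longrightarrow> stepanov_diff (cbox 0 1) p \<phi> c F \<tau> s x \<le> ennreal (\<beta> / w s)"
    and R: "R = M + norm \<tau> + 2 * real CARD('n) + 1"
    and near: "(\<integral>\<^sup>+s. ennreal ((1 + cmod c) * C * cmod (h (t - s))) * indicator (ball 0 R) s \<partial>lebesgue) \<le> ennreal b"
    and b: "0 \<le> b" "\<phi> 0 = 0 \<Longrightarrow> \<psi> 2 * \<phi> b \<le> 2 * \<beta> * \<gamma>"
  shows "ennreal (\<phi> (norm (conv h F (u + t + \<tau>) x - c *\<^sub>C conv h F (u + t) x)))
      \<le> ennreal \<beta> * (ennreal (\<psi> 2) * kernel_sum w t u + ennreal \<gamma>)"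
proof (cases "\<phi> 0 = 0")
  case False
  then have "kernel_sum w t u = \<infinity>"
    using \<phi>_nonneg[of 0] by (intro kernel_sum_infinite[OF _ w \<beta> far]) auto
  then show ?thesis using \<beta> \<psi>_2_pos by (simp add: ennreal_mult_top)
next
  case \<phi>0: True
  define D where "D s = norm (F (s + \<tau>) x - c *\<^sub>C F s x)" for s
  define G where "G s = cmod (h (t - s)) * D (u + s)" for s
  define Far where "Far = {k. M \<le> norm (u + lattice_pt k) \<and> M \<le> norm (u + lattice_pt k + \<tau>)}"
  define G1 where "G1 s = G s * indicator Far (floor_vec s)" for s
  define G2 where "G2 s = G s * indicator (- Far) (floor_vec s)" for s
  let ?N = "norm (conv h F (u + t + \<tau>) x - c *\<^sub>C conv h F (u + t) x)"
  have D0: "0 \<le> D s" for s by (simp add: D_def)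
  have DC: "D s \<le> (1 + cmod c) * C" for s
  proof -
    have "D s \<le> norm (F (s + \<tau>) x) + cmod c * norm (F s x)"
      unfolding D_def by (metis norm_scaleC norm_triangle_ineq4)
    also have "\<dots> \<le> C + cmod c * C" by (intro add_mono mult_left_mono C) auto
    finally show ?thesis by (simp add: algebra_simps)
  qed
  have C0: "0 \<le> (1 + cmod c) * C" using DC[of 0] D0[of 0] by linarith
  have G0: "0 \<le> G s" for s by (simp add: G_def D0)
  have Gm: "G \<in> borel_measurable lebesgue"
    using borel_measurable_conv_diff[where h = h and F = F and x = x and t = t and u = u and \<tau> = \<tau> and c = c, OF conv] by (simp add: G_def[abs_def] D_def)
  have N: "ennreal ?N \<le> (\<integral>\<^sup>+s. ennreal (G s) \<partial>lebesgue)"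
    using norm_conv_diff_le[where h = h and F = F and x = x and t = t and u = u and \<tau> = \<tau> and c = c, OF conv] by (simp add: G_def D_def)
  have G1m: "G1 \<in> borel_measurable lebesgue" and G2m: "G2 \<in> borel_measurable lebesgue"
    unfolding G1_def[abs_def] G2_def[abs_def]
    by (intro borel_measurable_times Gm borel_measurable_floor_vec)+
  have G1_0: "0 \<le> G1 s" and G2_0: "0 \<le> G2 s" for s
    using G0 by (simp_all add: G1_def G2_def)
  have G_eq: "G s = G1 s + G2 s" for s
    by (simp add: G1_def G2_def split: split_indicator)
  have G_le: "G s \<le> (1 + cmod c) * C * cmod (h (t - s))" for s
    unfolding G_def using mult_left_mono[OF DC[of "u + s"], of "cmod (h (t - s))"] by (simp add: mult.commute)
  have B_le: "(\<integral>\<^sup>+s. ennreal (G2 s) \<partial>lebesgue) \<le> ennreal b"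
  proof -
    have "(\<integral>\<^sup>+s. ennreal (G2 s) \<partial>lebesgue)
        \<le> (\<integral>\<^sup>+s. ennreal ((1 + cmod c) * C * cmod (h (t - s))) * indicator (ball 0 R) s \<partial>lebesgue)"
    proof (rule nn_integral_mono)
      fix s
      \<comment> \<open>With \<open>k\<close> the lattice point of the cell of \<open>s\<close>,
        write \<open>s = (u + k) + (s - k) - u\<close>. The first vector is shorter than
        \<open>M + norm \<tau>\<close> on a near cell; the others lie in the unit cube and have norm
        at most \<open>CARD('n)\<close>.\<close>
      have "s \<in> ball 0 R" if "floor_vec s \<notin> Far"
      proof -
        let ?k = "lattice_pt (floor_vec s)"
        from that have "norm (u + ?k) < M \<or> norm (u + ?k + \<tau>) < M" by (auto simp: Far_def)
        moreover have "norm (u + ?k) \<le> norm (u + ?k + \<tau>) + norm \<tau>"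
          using norm_triangle_ineq4[of "u + ?k + \<tau>" \<tau>] by simp
        ultimately have "norm (u + ?k) < M + norm \<tau>" using norm_ge_zero[of \<tau>] by linarith
        moreover have "norm s \<le> norm (u + ?k) + (norm (s - ?k) + norm u)"
          using norm_triangle_ineq[of "u + ?k" "(s - ?k) - u"] norm_triangle_ineq4[of "s - ?k" u] by simp
        ultimately show ?thesis
          using norm_le_CARD_of_unit_cbox[OF floor_vec_translate[of s]] norm_le_CARD_of_unit_cbox[OF u]
          by (simp add: R)
      qed
      then show "ennreal (G2 s) \<le> ennreal ((1 + cmod c) * C * cmod (h (t - s))) * indicator (ball 0 R) s"
        using G_le[of s] by (auto simp: G2_def ennreal_leI split: split_indicator)
    qed
    then show ?thesis using near by (rule order_trans)
  qed
  \<comment> \<open>Finiteness turns both parts into real numbers, to which \<open>\<phi>\<close>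
    can be applied.\<close>
  have "(\<integral>\<^sup>+s. ennreal (G s) \<partial>lebesgue) < \<infinity>"
  proof -
    have hm: "(\<lambda>y. ennreal (cmod (h y))) \<in> borel_measurable lebesgue"
      using h by (intro measurable_compose[OF _ measurable_ennreal]) auto
    have "(\<integral>\<^sup>+s. ennreal (G s) \<partial>lebesgue) \<le> (\<integral>\<^sup>+s. ennreal ((1 + cmod c) * C) * ennreal (cmod (h (t - s))) \<partial>lebesgue)"
      using C0 G_le by (intro nn_integral_mono) (simp add: ennreal_leI flip: ennreal_mult)
    also have "\<dots> = ennreal ((1 + cmod c) * C) * (\<integral>\<^sup>+s. ennreal (cmod (h (t - s))) \<partial>lebesgue)"
      by (rule nn_integral_cmult[OF measurable_compose[OF lebesgue_reflect_measurable hm]])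
    also have "(\<integral>\<^sup>+s. ennreal (cmod (h (t - s))) \<partial>lebesgue) = (\<integral>\<^sup>+s. ennreal (cmod (h s)) \<partial>lebesgue)"
      by (rule nn_integral_lebesgue_reflect[OF hm])
    also have "ennreal ((1 + cmod c) * C) * \<dots> < \<infinity>"
      using h by (simp add: integrable_iff_bounded ennreal_mult_less_top)
    finally show ?thesis .
  qed
  moreover have split: "(\<integral>\<^sup>+s. ennreal (G s) \<partial>lebesgue) = (\<integral>\<^sup>+s. ennreal (G1 s) \<partial>lebesgue) + (\<integral>\<^sup>+s. ennreal (G2 s) \<partial>lebesgue)"
    unfolding G_eq using G1m G2m by (simp add: ennreal_plus G1_0 G2_0 nn_integral_add)
  ultimately obtain A B where A: "(\<integral>\<^sup>+s. ennreal (G1 s) \<partial>lebesgue) = ennreal A" "0 \<le> A"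
    and B: "(\<integral>\<^sup>+s. ennreal (G2 s) \<partial>lebesgue) = ennreal B" "0 \<le> B"
    by (metis ennreal_cases ennreal_add_eq_top infinity_ennreal_def less_irrefl)
  have Bb: "B \<le> b" using B_le B b(1) by (simp add: ennreal_le_iff)
  have "?N \<le> A + B"
    using N A B unfolding split by (simp add: ennreal_le_iff flip: ennreal_plus)
  then have "\<phi> ?N \<le> \<phi> (2 * (1/2 * A + 1/2 * B))"
    by (intro \<phi>_mono) auto
  also have "\<dots> \<le> \<psi> 2 * \<phi> (1/2 * A + 1/2 * B)"
    using A B by (intro \<phi>_mult_le) auto
  also have "\<dots> \<le> \<psi> 2 * (1/2 * \<phi> A + 1/2 * \<phi> B)"
    using convex_onD[OF \<phi>_convex, of "1/2" A B] A B \<psi>_2_pos by (intro mult_left_mono) auto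
  also have "\<dots> \<le> \<psi> 2 / 2 * \<phi> A + \<psi> 2 / 2 * \<phi> b"
    using \<phi>_mono[OF B(2) Bb] \<psi>_2_pos by (simp add: algebra_simps)
  also have "\<dots> \<le> \<psi> 2 / 2 * \<phi> A + \<beta> * \<gamma>"
    using b(2)[OF \<phi>0] by simp
  finally have "ennreal (\<phi> ?N) \<le> ennreal (\<psi> 2 / 2) * ennreal (\<phi> A) + ennreal (\<beta> * \<gamma>)"
    using \<psi>_2_pos \<phi>_nonneg[OF A(2)] \<beta> \<gamma> by (simp add: ennreal_leI flip: ennreal_mult ennreal_plus)
  also have "\<dots> \<le> ennreal (\<psi> 2 / 2) * (ennreal (2 * \<beta>) * kernel_sum w t u) + ennreal (\<beta> * \<gamma>)"
  proof (intro add_right_mono mult_left_mono)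
    let ?f = "\<lambda>s. ennreal (a (floor_vec s) * \<phi> (G1 s / a (floor_vec s)))"
    have am: "(\<lambda>s. a (floor_vec s)) \<in> borel_measurable lebesgue"
      by (rule borel_measurable_floor_vec)
    have "ennreal (\<phi> A) \<le> (\<integral>\<^sup>+s. ?f s \<partial>lebesgue)"
      using nn_integral_floor_vec_weight_le[OF _ a_sum] a_pos
      by (intro Jensen_density[OF \<phi>_convex \<phi>_mono_on \<phi>0 am _ _ G1m G1_0 A]) (auto simp: less_imp_le)
    also have "\<dots> \<le> (\<Sum>\<^sub>\<infinity>k\<in>UNIV. \<integral>\<^sup>+s. ?f s * indicator {s. floor_vec s = k} s \<partial>lebesgue)"
    proof (rule nn_integral_floor_vec_le)
      have "(\<lambda>s. \<phi> (G1 s / a (floor_vec s))) \<in> borel_measurable lebesgue"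
        using G1_0 a_pos by (intro borel_measurable_mono_on_nonneg[OF \<phi>_mono_on] borel_measurable_divide G1m am)
          (auto intro: divide_nonneg_pos)
      then show "?f \<in> borel_measurable lebesgue"
        by (intro measurable_compose[OF _ measurable_ennreal] borel_measurable_times am)
    qed
    also have "\<dots> \<le> (\<Sum>\<^sub>\<infinity>k\<in>UNIV. ennreal (2 * \<beta>) * kernel_term w t u k)"
    proof (intro infsum_mono nonneg_summable_on_complete)
      fix k
      \<comment> \<open>On a near cell \<open>G1\<close> vanishes, and \<open>\<phi> 0 = 0\<close>
        removes the cell from the sum; there the \<open>Far\<close> condition would give no
        bound.\<close>
      have "(\<integral>\<^sup>+s. ?f s * indicator {s. floor_vec s = k} s \<partial>lebesgue)
          = (\<integral>\<^sup>+s. indicator Far k * (ennreal (a k * \<phi> (G s / a k)) * indicator {s. floor_vec s = k} s) \<partial>lebesgue)"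
        by (intro nn_integral_cong) (auto simp: G1_def \<phi>0 split: split_indicator)
      also have "\<dots> \<le> ennreal (2 * \<beta>) * kernel_term w t u k"
      proof (cases "k \<in> Far")
        case True
        have bound: "lux_norm (cbox 0 1) p (\<lambda>\<sigma>. \<phi> (D (\<sigma> + (u + lattice_pt k)))) \<le> ennreal (\<beta> / w (u + lattice_pt k))"
          using far[of "u + lattice_pt k"] True by (simp add: stepanov_diff_def D_def Far_def)
        show ?thesis
          using nn_integral_far_cell_le[of \<beta> w u k D G t, OF \<phi>0 \<beta> w D0 bound Gm G_def] True by simp
      qed simp
      finally show "(\<integral>\<^sup>+s. ?f s * indicator {s. floor_vec s = k} s \<partial>lebesgue) \<le> ennreal (2 * \<beta>) * kernel_term w t u k" .
    qed auto
    also have "\<dots> = ennreal (2 * \<beta>) * kernel_sum w t u"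
      unfolding kernel_sum_def by (rule infsum_cmult_ennreal)
    finally show "ennreal (\<phi> A) \<le> ennreal (2 * \<beta>) * kernel_sum w t u" .
  qed auto
  also have "\<dots> = ennreal \<beta> * (ennreal (\<psi> 2) * kernel_sum w t u + ennreal \<gamma>)"
  proof -
    have "ennreal (\<psi> 2 / 2) * ennreal (2 * \<beta>) = ennreal \<beta> * ennreal (\<psi> 2)"
      using \<beta> \<psi>_2_pos by (simp flip: ennreal_mult)
    then show ?thesis
      using \<beta> \<gamma> by (simp add: distrib_left ennreal_mult flip: mult.assoc)
  qed
  finally show ?thesis .
qed

text \<open>Dividing the pointwise bound by \<open>\<beta> / v\<close> cancels
  \<open>\<beta>\<close> and leaves exactly the argument of \<open>kernel_modular\<close>. Hence
  \<open>\<beta> / v\<close> is an admissible scale for the Luxemburg norm.\<close>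

lemma stepanov_diff_conv_le:
  fixes F :: "real^'n \<Rightarrow> 'x \<Rightarrow> 'y::complex_banach"
  assumes conv: "\<And>t. bochner_integrable lebesgue (\<lambda>\<sigma>. h \<sigma> *\<^sub>C F (t - \<sigma>) x)"
    and C: "\<And>s. norm (F s x) \<le> C"
    and \<beta>: "0 < \<beta>" and \<gamma>: "0 \<le> \<gamma>" and w: "\<And>s. 0 < w s" and v: "0 < v"
    and far: "\<And>s. M \<le> norm s \<Longrightarrow> M \<le> norm (s + \<tau>) \<Longrightarrow> stepanov_diff (cbox 0 1) p \<phi> c F \<tau> s x \<le> ennreal (\<beta> / w s)"
    and R: "R = M + norm \<tau> + 2 * real CARD('n) + 1"
    and near: "(\<integral>\<^sup>+s. ennreal ((1 + cmod c) * C * cmod (h (t - s))) * indicator (ball 0 R) s \<partial>lebesgue) \<le> ennreal b"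
    and b: "0 \<le> b" "\<phi> 0 = 0 \<Longrightarrow> \<psi> 2 * \<phi> b \<le> 2 * \<beta> * \<gamma>"
    and kernel: "kernel_modular (cbox 0 1) p q \<psi> a h w v \<gamma> t \<le> 1"
  shows "stepanov_diff (cbox 0 1) p \<phi> c (conv h F) \<tau> t x \<le> ennreal (\<beta> / v)"
  unfolding stepanov_diff_def
proof (rule lux_norm_le)
  let ?f = "\<lambda>u. \<phi> (norm (conv h F (u + t + \<tau>) x - c *\<^sub>C conv h F (u + t) x))"
  \<comment> \<open>Measurability has to be shown: the norm of a non-measurable function is infinite
    by convention.\<close>
  have cont: "continuous_on UNIV (\<lambda>t. conv h F t x)"
    by (rule conv_continuous[of h F x C, OF h C conv])
  have "continuous_on UNIV (\<lambda>u. norm (conv h F (u + t + \<tau>) x - c *\<^sub>C conv h F (u + t) x))"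
    by (intro continuous_on_norm continuous_on_diff bounded_linear.continuous_on[OF bounded_linear_scaleC]
        continuous_on_compose2[OF cont] continuous_intros) auto
  then have "(\<lambda>u. norm (conv h F (u + t + \<tau>) x - c *\<^sub>C conv h F (u + t) x)) \<in> borel_measurable borel"
    by (rule borel_measurable_continuous_onI)
  then have "(\<lambda>u. norm (conv h F (u + t + \<tau>) x - c *\<^sub>C conv h F (u + t) x)) \<in> borel_measurable lebesgue"
    by (simp add: measurable_completion)
  then show "?f \<in> borel_measurable (lebesgue_on (cbox 0 1))"
    by (intro measurable_restrict_space1 borel_measurable_mono_on_nonneg[OF \<phi>_mono_on]) auto
  show "0 < \<beta> / v" using \<beta> v by simp
  have "var_modular (cbox 0 1) p (\<lambda>u. ?f u / (\<beta> / v)) \<le> kernel_modular (cbox 0 1) p q \<psi> a h w v \<gamma> t"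
    unfolding var_modular_def kernel_modular_def
  proof (rule nn_integral_mono)
    fix u :: "real^'n" assume "u \<in> space (lebesgue_on (cbox 0 1))"
    then have u: "u \<in> cbox 0 1" by simp
    have "ennreal \<bar>?f u / (\<beta> / v)\<bar> = ennreal (v / \<beta>) * ennreal (?f u)"
      using \<beta> v \<phi>_nonneg by (simp add: abs_mult mult.commute flip: ennreal_mult)
    also have "\<dots> \<le> ennreal (v / \<beta>) * (ennreal \<beta> * (ennreal (\<psi> 2) * kernel_sum w t u + ennreal \<gamma>))"
      by (intro mult_left_mono \<phi>_conv_diff_le[OF conv C \<beta> \<gamma> w u far R near b]) auto
    also have "\<dots> = ennreal v * (ennreal (\<psi> 2) * kernel_sum w t u + ennreal \<gamma>)"
      using \<beta> v by (simp flip: mult.assoc ennreal_mult)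
    finally show "phi_pow (p u) (ennreal \<bar>?f u / (\<beta> / v)\<bar>)
        \<le> phi_pow (p u) (ennreal v * (ennreal (\<psi> 2) *
          (\<Sum>\<^sub>\<infinity>k\<in>UNIV. ennreal (a k * \<psi> (inverse (a k))) *
             lux_norm (cbox 0 1) q (\<lambda>\<sigma>. \<psi> (cmod (h (t - \<sigma> - lattice_pt k)))) / ennreal (w (u + lattice_pt k))) +
          ennreal \<gamma>))"
      unfolding kernel_sum_def kernel_term_def by (rule phi_pow_mono)
  qed
  then show "var_modular (cbox 0 1) p (\<lambda>u. ?f u / (\<beta> / v)) \<le> 1"
    using kernel by (rule order_trans)
qed

text \<open>If \<open>norm t \<ge> R + r\<close> and \<open>s\<close> lies in the ball of radius
  \<open>R\<close>, then \<open>norm (t - s) \<ge> r\<close>, so that only the tail of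
  \<open>h\<close> is integrated.\<close>

lemma near_part_small:
  assumes C: "0 \<le> C" and \<beta>: "0 < \<beta>" and \<gamma>: "0 < \<gamma>"
  obtains T b where "0 \<le> b" "\<phi> 0 = 0 \<Longrightarrow> \<psi> 2 * \<phi> b \<le> 2 * \<beta> * \<gamma>"
    "\<And>t. T \<le> norm t \<Longrightarrow> (\<integral>\<^sup>+s. ennreal (C * cmod (h (t - s))) * indicator (ball 0 R) s \<partial>lebesgue) \<le> ennreal b"
proof -
  \<comment> \<open>The cap 1 permits \<open>\<phi> b \<le> b * \<phi> 1\<close>, by convexity and
    \<open>\<phi> 0 = 0\<close>; the other entry solves the required inequality for
    \<open>b\<close>.\<close>
  define b where "b = min 1 (2 * \<beta> * \<gamma> / (\<psi> 2 * \<phi> 1))"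
  have b: "0 < b" "b \<le> 1" "\<psi> 2 * \<phi> 1 * b \<le> 2 * \<beta> * \<gamma>"
    using \<beta> \<gamma> \<psi>_2_pos \<phi>_1_pos by (auto simp: b_def min_def field_simps)
  have "\<psi> 2 * \<phi> b \<le> 2 * \<beta> * \<gamma>" if "\<phi> 0 = 0"
  proof -
    have "\<phi> b \<le> b * \<phi> 1" using \<phi>_convex_0[of b 1] b that by simp
    then have "\<psi> 2 * \<phi> b \<le> \<psi> 2 * (b * \<phi> 1)" using \<psi>_2_pos by simp
    then show ?thesis using b(3) by (simp add: ac_simps)
  qed
  moreover
  have "0 < b / (C + 1)" using b C by simp
  then obtain r where r: "(\<integral>\<^sup>+y. ennreal (norm (h y)) * indicator {y. r \<le> norm y} y \<partial>lebesgue) \<le> ennreal (b / (C + 1))"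
    using integrable_tail[OF h] by blast
  have hr: "(\<lambda>y. ennreal (norm (h y)) * indicator {y. r \<le> norm y} y) \<in> borel_measurable lebesgue"
    using h by (intro borel_measurable_times_ennreal borel_measurable_indicator sets_completionI_sets) auto
  have "(\<integral>\<^sup>+s. ennreal (C * cmod (h (t - s))) * indicator (ball 0 R) s \<partial>lebesgue) \<le> ennreal b"
    if t: "R + r \<le> norm t" for t
  proof -
    have "(\<integral>\<^sup>+s. ennreal (C * cmod (h (t - s))) * indicator (ball 0 R) s \<partial>lebesgue)
        \<le> (\<integral>\<^sup>+s. ennreal C * (ennreal (norm (h (t - s))) * indicator {y. r \<le> norm y} (t - s)) \<partial>lebesgue)"
    proof (rule nn_integral_mono)
      fix s
      have "r \<le> norm (t - s)" if "norm s < R"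
        using that t norm_triangle_ineq2[of t s] by linarith
      then show "ennreal (C * cmod (h (t - s))) * indicator (ball 0 R) s
          \<le> ennreal C * (ennreal (norm (h (t - s))) * indicator {y. r \<le> norm y} (t - s))"
        using C by (auto simp: ennreal_mult split: split_indicator)
    qed
    also have "\<dots> = ennreal C * (\<integral>\<^sup>+s. ennreal (norm (h (t - s))) * indicator {y. r \<le> norm y} (t - s) \<partial>lebesgue)"
      by (rule nn_integral_cmult[OF measurable_compose[OF lebesgue_reflect_measurable hr]])
    also have "\<dots> = ennreal C * (\<integral>\<^sup>+y. ennreal (norm (h y)) * indicator {y. r \<le> norm y} y \<partial>lebesgue)"
      by (simp only: nn_integral_lebesgue_reflect[OF hr])
    also have "\<dots> \<le> ennreal C * ennreal (b / (C + 1))"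
      by (intro mult_left_mono r) auto
    also have "\<dots> = ennreal (C * (b / (C + 1)))"
      using C b by (intro ennreal_mult[symmetric]) auto
    also have "\<dots> \<le> ennreal b"
      using C b by (intro ennreal_leI) (simp add: field_simps)
    finally show ?thesis .
  qed
  ultimately show ?thesis
    using that[of b "R + r"] b by auto
qed

text \<open>The step shared by both notions: \<open>\<tau>\<close> and the tolerance
  \<open>\<beta>\<close> are kept and only the threshold grows, to \<open>max L (max M' T)\<close>.
  The parameter \<open>L\<close> lets the caller prescribe a lower bound for it.\<close>

lemma SUP_stepanov_diff_conv_le:
  fixes F :: "real^'n \<Rightarrow> 'x \<Rightarrow> 'y::complex_banach"
  assumes conv: "\<And>t x. bochner_integrable lebesgue (\<lambda>\<sigma>. h \<sigma> *\<^sub>C F (t - \<sigma>) x)"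
    and C: "0 \<le> C" "\<And>s x. x \<in> B \<Longrightarrow> norm (F s x) \<le> C"
    and \<beta>: "0 < \<beta>" and \<gamma>: "0 < \<gamma>" and w: "\<And>s. 0 < w s" and v: "\<And>s. 0 < v s"
    and SUP: "(SUP (t, x) \<in> {(t, x). M \<le> norm t \<and> M \<le> norm (t + \<tau>) \<and> x \<in> B}.
      ennreal (w t) * stepanov_diff (cbox 0 1) p \<phi> c F \<tau> t x) \<le> ennreal \<beta>"
    and kernel: "\<exists>M'>0. \<forall>t. M' \<le> norm t \<longrightarrow> kernel_modular (cbox 0 1) p q \<psi> a h w (v t) \<gamma> t \<le> 1"
  shows "\<exists>m\<ge>L. (SUP (t, x) \<in> {(t, x). m \<le> norm t \<and> m \<le> norm (t + \<tau>) \<and> x \<in> B}.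
      ennreal (v t) * stepanov_diff (cbox 0 1) p \<phi> c (conv h F) \<tau> t x) \<le> ennreal \<beta>"
proof -
  have C': "0 \<le> (1 + cmod c) * C" using C(1) by simp
  obtain M' where M': "\<And>t. M' \<le> norm t \<Longrightarrow> kernel_modular (cbox 0 1) p q \<psi> a h w (v t) \<gamma> t \<le> 1"
    using kernel by blast
  have far: "stepanov_diff (cbox 0 1) p \<phi> c F \<tau> s x \<le> ennreal (\<beta> / w s)"
    if "x \<in> B" "M \<le> norm s" "M \<le> norm (s + \<tau>)" for s x
  proof -
    have "ennreal (w s) * stepanov_diff (cbox 0 1) p \<phi> c F \<tau> s x \<le> ennreal \<beta>"
      using that by (intro order_trans[OF SUP_upper2[of "(s, x)"] SUP]) auto
    then show ?thesis
      using w \<beta> by (simp add: ennreal_mult_le_iff_le_divide)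
  qed
  show ?thesis
  proof (rule near_part_small[OF C' \<beta> \<gamma>, where R = "M + norm \<tau> + 2 * real CARD('n) + 1"])
    fix T b
    assume b: "0 \<le> b" "\<phi> 0 = 0 \<Longrightarrow> \<psi> 2 * \<phi> b \<le> 2 * \<beta> * \<gamma>"
      and T: "\<And>t. T \<le> norm t \<Longrightarrow> (\<integral>\<^sup>+s. ennreal ((1 + cmod c) * C * cmod (h (t - s))) *
        indicator (ball 0 (M + norm \<tau> + 2 * real CARD('n) + 1)) s \<partial>lebesgue) \<le> ennreal b"
    let ?m = "max L (max M' T)"
    have "ennreal (v t) * stepanov_diff (cbox 0 1) p \<phi> c (conv h F) \<tau> t x \<le> ennreal \<beta>"
      if t: "M' \<le> norm t" "T \<le> norm t" and x: "x \<in> B" for t x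
    proof -
      have "stepanov_diff (cbox 0 1) p \<phi> c (conv h F) \<tau> t x \<le> ennreal (\<beta> / v t)"
        by (rule stepanov_diff_conv_le[where F = F, OF conv C(2)[OF x] \<beta> less_imp_le[OF \<gamma>] w v
            far[OF x] refl T[OF t(2)] b M'[OF t(1)]])
      then show ?thesis
        using v \<beta> by (simp add: ennreal_mult_le_iff_le_divide)
    qed
    then have "(SUP (t, x) \<in> {(t, x). ?m \<le> norm t \<and> ?m \<le> norm (t + \<tau>) \<and> x \<in> B}.
      ennreal (v t) * stepanov_diff (cbox 0 1) p \<phi> c (conv h F) \<tau> t x) \<le> ennreal \<beta>"
      by (intro SUP_least) auto
    then show ?thesis by (intro exI[of _ ?m]) auto
  qed
qed

end

section \<open>Transfer of both notions to the convolution\<close>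

theorem theorem4p6:
  fixes \<B> :: "'x::complex_banach set set"
    and \<Omega> \<Lambda>' :: "(real^'n) set"
    and c :: complex
    and p q :: "real^'n \<Rightarrow> ennreal"
    and W W1 :: "real^'n \<Rightarrow> real \<Rightarrow> real^'n \<Rightarrow> real"
    and V V1 :: "real^'n \<Rightarrow> nat \<Rightarrow> real"
    and F :: "real^'n \<Rightarrow> 'x \<Rightarrow> 'y::complex_banach"
    and \<phi> \<psi> g :: "real \<Rightarrow> real"
    and h :: "real^'n \<Rightarrow> complex"
    and a :: "int^'n \<Rightarrow> real"
  assumes \<Omega>: "\<Omega> = cbox 0 1"
    and \<B>: "\<And>B. B \<in> \<B> \<Longrightarrow> B \<noteq> {}" "\<Union>\<B> = UNIV"
    and \<Lambda>': "\<Lambda>' \<noteq> {}" "\<not> bounded \<Lambda>'"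
    and c: "c \<noteq> 0"
    and pq: "p \<in> var_exponents \<Omega>" "q \<in> var_exponents \<Omega>"
    and conjugate: "AE u in lebesgue_on \<Omega>. inverse (p u) + inverse (q u) = 1"
    and W_pos: "\<And>t \<epsilon> \<tau>. 0 < \<epsilon> \<Longrightarrow> \<tau> \<in> \<Lambda>' \<Longrightarrow> 0 < W t \<epsilon> \<tau> \<and> 0 < W1 t \<epsilon> \<tau>"
    and V_pos: "\<And>t m. 1 \<le> m \<Longrightarrow> 0 < V t m \<and> 0 < V1 t m"
    and \<phi>: "\<phi> ` {0..} \<subseteq> {0..}" "convex_on {0..} \<phi>" "strict_mono_on {0..} \<phi>"
    and \<psi>: "\<psi> ` {0..} \<subseteq> {0..}" "\<And>x y. 0 \<le> x \<Longrightarrow> 0 \<le> y \<Longrightarrow> \<phi> (x * y) \<le> \<psi> x * \<phi> y"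
    and h: "integrable lebesgue h"
    and F_bounded: "\<And>B. B \<in> \<B> \<Longrightarrow> bounded ((\<lambda>(t, x). F t x) ` (UNIV \<times> B))"
    and conv_exists: "\<And>t x. bochner_integrable lebesgue (\<lambda>\<sigma>. h \<sigma> *\<^sub>C F (t - \<sigma>) x)"
    and g: "g ` {0..} \<subseteq> {0..}" "continuous_on {0..} g" "filterlim g (at_right 0) (at_right 0)"
    and a: "\<And>k. 0 < a k" "(a has_sum 1) UNIV"
  shows
    "(stepanov_quasi_aap \<Omega> \<B> \<Lambda>' p \<phi> W c F \<longrightarrow>
      (\<forall>s>0. 0 < g s) \<longrightarrow>
      (\<forall>\<epsilon>>0. \<forall>\<tau>\<in>\<Lambda>'. \<exists>M'>0. \<forall>t. M' \<le> norm t \<longrightarrow>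
         kernel_modular \<Omega> p q \<psi> a h (\<lambda>s. W s \<epsilon> \<tau>) (W1 t \<epsilon> \<tau>) (g \<epsilon>) t \<le> 1) \<longrightarrow>
      stepanov_quasi_aap \<Omega> \<B> \<Lambda>' p \<phi> W1 c (conv h F))
     \<and>
     (stepanov_quasi_aur \<Omega> \<B> \<Lambda>' p \<phi> V c F \<longrightarrow>
      (\<forall>m\<ge>1. \<forall>\<tau>\<in>\<Lambda>'. \<exists>M'>0. \<forall>t. M' \<le> norm t \<longrightarrow>
         kernel_modular \<Omega> p q \<psi> a h (\<lambda>s. V s m) (V1 t m) (g (1 / real m)) t \<le> 1) \<longrightarrow>
      stepanov_quasi_aur \<Omega> \<B> \<Lambda>' p \<phi> V1 c (conv h F))"
proof -
  interpret convolution_kernel p q \<phi> \<psi> a h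
    by unfold_locales (use pq[unfolded \<Omega>] conjugate[unfolded \<Omega>] \<phi> \<psi> h a in \<open>auto simp: image_subset_iff\<close>)
  have bound: "\<exists>C\<ge>0. \<forall>x\<in>B. \<forall>s. norm (F s x) \<le> C" if B: "B \<in> \<B>" for B
  proof -
    obtain C where C: "\<forall>y\<in>(\<lambda>(t, x). F t x) ` (UNIV \<times> B). norm y \<le> C"
      using bounded_iff[THEN iffD1, OF F_bounded[OF B]] by blast
    have "norm (F s x) \<le> C" if "x \<in> B" for s x
      using bspec[OF C, of "F s x"] that by force
    then have "norm (F s x) \<le> max 0 C" if "x \<in> B" for s x
      using that by (simp add: le_max_iff_disj)
    then show ?thesis by (intro exI[of _ "max 0 C"]) auto
  qed
  show ?thesis
    unfolding \<Omega>
  proof (intro conjI impI)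
    assume F: "stepanov_quasi_aap (cbox 0 1) \<B> \<Lambda>' p \<phi> W c F"
      and g_pos: "\<forall>s>0. 0 < g s"
      and kernel: "\<forall>\<epsilon>>0. \<forall>\<tau>\<in>\<Lambda>'. \<exists>M'>0. \<forall>t. M' \<le> norm t \<longrightarrow>
         kernel_modular (cbox 0 1) p q \<psi> a h (\<lambda>s. W s \<epsilon> \<tau>) (W1 t \<epsilon> \<tau>) (g \<epsilon>) t \<le> 1"
    show "stepanov_quasi_aap (cbox 0 1) \<B> \<Lambda>' p \<phi> W1 c (conv h F)"
      unfolding stepanov_quasi_aap_def
    proof (intro ballI allI impI)
      fix B and \<epsilon> :: real assume B: "B \<in> \<B>" and \<epsilon>: "0 < \<epsilon>"
      obtain C where C: "0 \<le> C" "\<And>s x. x \<in> B \<Longrightarrow> norm (F s x) \<le> C"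
        using bound[OF B] by blast
      obtain l where l: "0 < l" "\<forall>t0\<in>\<Lambda>'. \<exists>\<tau>\<in>cball t0 l \<inter> \<Lambda>'. \<exists>M>0.
          (SUP (t, x) \<in> {(t, x). M \<le> norm t \<and> M \<le> norm (t + \<tau>) \<and> x \<in> B}.
             ennreal (W t \<epsilon> \<tau>) * stepanov_diff (cbox 0 1) p \<phi> c F \<tau> t x) \<le> ennreal \<epsilon>"
        using F[unfolded stepanov_quasi_aap_def, rule_format, OF B \<epsilon>] by (elim exE conjE) (rule that)
      \<comment> \<open>The length \<open>l\<close> and the translation \<open>\<tau>\<close> found
        for \<open>F\<close> serve the convolution as well.\<close>
      have "\<exists>\<tau>\<in>cball t0 l \<inter> \<Lambda>'. \<exists>M>0.
          (SUP (t, x) \<in> {(t, x). M \<le> norm t \<and> M \<le> norm (t + \<tau>) \<and> x \<in> B}.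
             ennreal (W1 t \<epsilon> \<tau>) * stepanov_diff (cbox 0 1) p \<phi> c (conv h F) \<tau> t x) \<le> ennreal \<epsilon>"
        if t0: "t0 \<in> \<Lambda>'" for t0
      proof -
        obtain \<tau> M where \<tau>: "\<tau> \<in> cball t0 l \<inter> \<Lambda>'" and M: "0 < M"
          and SUP: "(SUP (t, x) \<in> {(t, x). M \<le> norm t \<and> M \<le> norm (t + \<tau>) \<and> x \<in> B}.
             ennreal (W t \<epsilon> \<tau>) * stepanov_diff (cbox 0 1) p \<phi> c F \<tau> t x) \<le> ennreal \<epsilon>"
          using bspec[OF l(2) t0] by (elim bexE exE conjE) (rule that)
        have W: "0 < W s \<epsilon> \<tau>" "0 < W1 s \<epsilon> \<tau>" for s using W_pos \<epsilon> \<tau> by auto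
        have g\<epsilon>: "0 < g \<epsilon>" using g_pos \<epsilon> by simp
        have kernel': "\<exists>M'>0. \<forall>t. M' \<le> norm t \<longrightarrow>
            kernel_modular (cbox 0 1) p q \<psi> a h (\<lambda>s. W s \<epsilon> \<tau>) (W1 t \<epsilon> \<tau>) (g \<epsilon>) t \<le> 1"
          using kernel \<epsilon> \<tau> by blast
        \<comment> \<open>The value \<open>L = 1\<close> makes the new threshold positive.\<close>
        have "\<exists>m\<ge>1. (SUP (t, x) \<in> {(t, x). m \<le> norm t \<and> m \<le> norm (t + \<tau>) \<and> x \<in> B}.
             ennreal (W1 t \<epsilon> \<tau>) * stepanov_diff (cbox 0 1) p \<phi> c (conv h F) \<tau> t x) \<le> ennreal \<epsilon>"
          by (rule SUP_stepanov_diff_conv_le[where F = F and w = "\<lambda>s. W s \<epsilon> \<tau>",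
              OF conv_exists C \<epsilon> g\<epsilon> W SUP kernel'])
        then show ?thesis
        proof (elim exE conjE, intro bexI[OF _ \<tau>] exI conjI)
          fix m :: real assume "1 \<le> m" then show "0 < m" by simp
        qed
      qed
      then show "\<exists>l>0. \<forall>t0\<in>\<Lambda>'. \<exists>\<tau>\<in>cball t0 l \<inter> \<Lambda>'. \<exists>M>0.
          (SUP (t, x) \<in> {(t, x). M \<le> norm t \<and> M \<le> norm (t + \<tau>) \<and> x \<in> B}.
             ennreal (W1 t \<epsilon> \<tau>) * stepanov_diff (cbox 0 1) p \<phi> c (conv h F) \<tau> t x) \<le> ennreal \<epsilon>"
        by (intro exI[of _ l] conjI l(1) ballI)
    qed
  next
    assume F: "stepanov_quasi_aur (cbox 0 1) \<B> \<Lambda>' p \<phi> V c F"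
      and kernel: "\<forall>m\<ge>1. \<forall>\<tau>\<in>\<Lambda>'. \<exists>M'>0. \<forall>t. M' \<le> norm t \<longrightarrow>
         kernel_modular (cbox 0 1) p q \<psi> a h (\<lambda>s. V s m) (V1 t m) (g (1 / real m)) t \<le> 1"
    show "stepanov_quasi_aur (cbox 0 1) \<B> \<Lambda>' p \<phi> V1 c (conv h F)"
      unfolding stepanov_quasi_aur_def
    proof (rule ballI)
      fix B assume B: "B \<in> \<B>"
      obtain C where C: "0 \<le> C" "\<And>s x. x \<in> B \<Longrightarrow> norm (F s x) \<le> C"
        using bound[OF B] by blast
      define S where "S G U M \<tau> k = (SUP (t, x) \<in> {(t, x). M \<le> norm t \<and> M \<le> norm (t + \<tau>) \<and> x \<in> B}.
          ennreal (U t k) * stepanov_diff (cbox 0 1) p \<phi> c G \<tau> t x)"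
        for G :: "real^'n \<Rightarrow> 'x \<Rightarrow> 'y" and U :: "real^'n \<Rightarrow> nat \<Rightarrow> real" and M :: real and \<tau> :: "real^'n" and k :: nat
      obtain \<tau> :: "nat \<Rightarrow> real^'n" and M :: "nat \<Rightarrow> real" where
        \<tau>: "\<forall>k\<ge>1. \<tau> k \<in> \<Lambda>'" "strict_mono_on {1..} (\<lambda>k. norm (\<tau> k))"
          "filterlim (\<lambda>k. norm (\<tau> k)) at_top sequentially"
        and M: "\<forall>k\<ge>1. 0 < M k" "filterlim M at_top sequentially"
        and S: "(\<lambda>k. S F V (M k) (\<tau> k) k) \<longlonglongrightarrow> 0"
        using F[unfolded stepanov_quasi_aur_def, rule_format, OF B, folded S_def] by (elim exE conjE) (rule that)
      \<comment> \<open>The estimate needs a strictly positive tolerance, whereas the supremum for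
        \<open>F\<close> may be 0; adding \<open>1 / real k\<close> repairs this and still tends to
        0.\<close>
      define e where "e k = enn2real (S F V (M k) (\<tau> k) k) + 1 / real k" for k
      \<comment> \<open>For finitely many \<open>k\<close> the supremum may be infinite or
        \<open>g (1 / real k)\<close> may be 0. The implications let the choice of thresholds run
        over all \<open>k\<close>, with \<open>M k\<close> itself as witness there.\<close>
      have "\<exists>m. M k \<le> m \<and> (S F V (M k) (\<tau> k) k < \<infinity> \<longrightarrow> 0 < g (1 / real k) \<longrightarrow>
          S (conv h F) V1 m (\<tau> k) k \<le> ennreal (e k))" if k: "1 \<le> k" for k
      proof (cases "S F V (M k) (\<tau> k) k < \<infinity> \<and> 0 < g (1 / real k)")
        case True
        have e: "0 < e k" using k by (auto simp: e_def intro: add_nonneg_pos)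
        have V: "0 < V s k" "0 < V1 s k" for s using V_pos k by auto
        have "S F V (M k) (\<tau> k) k = ennreal (enn2real (S F V (M k) (\<tau> k) k))"
          using True by simp
        also have "\<dots> \<le> ennreal (e k)" by (intro ennreal_leI) (simp add: e_def)
        finally have SUP: "S F V (M k) (\<tau> k) k \<le> ennreal (e k)" .
        have kernel': "\<exists>M'>0. \<forall>t. M' \<le> norm t \<longrightarrow>
            kernel_modular (cbox 0 1) p q \<psi> a h (\<lambda>s. V s k) (V1 t k) (g (1 / real k)) t \<le> 1"
          using kernel k \<tau>(1) by blast
        have gk: "0 < g (1 / real k)" using True by simp
        have "\<exists>m\<ge>M k. S (conv h F) V1 m (\<tau> k) k \<le> ennreal (e k)"
          unfolding S_def
          by (rule SUP_stepanov_diff_conv_le[where F = F and w = "\<lambda>s. V s k",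
              OF conv_exists C e gk V SUP[unfolded S_def] kernel'])
        then show ?thesis by blast
      qed auto
      then obtain M2 where M2: "\<And>k. 1 \<le> k \<Longrightarrow> M k \<le> M2 k"
        and S2: "\<And>k. 1 \<le> k \<Longrightarrow> S F V (M k) (\<tau> k) k < \<infinity> \<Longrightarrow> 0 < g (1 / real k) \<Longrightarrow>
          S (conv h F) V1 (M2 k) (\<tau> k) k \<le> ennreal (e k)"
        by metis
      have M2_pos: "\<forall>k\<ge>1. 0 < M2 k" using M(1) M2 by (meson less_le_trans)
      \<comment> \<open>The thresholds were chosen with \<open>L = M k\<close>, so divergence is
        inherited from \<open>M\<close>.\<close>
      have M2_lim: "filterlim M2 at_top sequentially"
        using M2 by (intro filterlim_at_top_mono[OF M(2)] eventually_sequentiallyI[of 1])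
      have "filterlim (\<lambda>k. 1 / real k) (at_right 0) sequentially"
        using lim_1_over_n by (auto simp: filterlim_at intro!: eventually_sequentiallyI[of 1])
      then have "filterlim (\<lambda>k. g (1 / real k)) (at_right 0) sequentially"
        by (rule filterlim_compose[OF g(3)])
      \<comment> \<open>The filter \<open>at_right 0\<close> excludes 0: convergence of
        \<open>g\<close> to 0 from the right contains its positivity near 0.\<close>
      then have g_ev: "\<forall>\<^sub>F k in sequentially. 0 < g (1 / real k)"
        by (auto simp: filterlim_at elim: eventually_mono)
      have S_ev: "\<forall>\<^sub>F k in sequentially. S F V (M k) (\<tau> k) k < \<infinity>"
        using order_tendstoD(2)[OF S, of \<infinity>] by simp
      have S2_lim: "(\<lambda>k. S (conv h F) V1 (M2 k) (\<tau> k) k) \<longlonglongrightarrow> 0"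
      proof (rule tendsto_sandwich[where f = "\<lambda>_. 0" and h = "\<lambda>k. ennreal (e k)"])
        show "\<forall>\<^sub>F k in sequentially. S (conv h F) V1 (M2 k) (\<tau> k) k \<le> ennreal (e k)"
          using g_ev S_ev eventually_ge_at_top[of 1] by eventually_elim (rule S2)
        have "(\<lambda>k. enn2real (S F V (M k) (\<tau> k) k)) \<longlonglongrightarrow> enn2real 0"
          using S by (intro tendsto_enn2real) auto
        then have "e \<longlonglongrightarrow> 0"
          unfolding e_def using tendsto_add lim_1_over_n by fastforce
        then show "(\<lambda>k. ennreal (e k)) \<longlonglongrightarrow> 0"
          using tendsto_ennrealI by fastforce
      qed auto
      show "\<exists>(\<tau> :: nat \<Rightarrow> real^'n) (M :: nat \<Rightarrow> real).
        (\<forall>k\<ge>1. \<tau> k \<in> \<Lambda>') \<and> strict_mono_on {1..} (\<lambda>k. norm (\<tau> k)) \<and>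
        filterlim (\<lambda>k. norm (\<tau> k)) at_top sequentially \<and>
        (\<forall>k\<ge>1. 0 < M k) \<and> filterlim M at_top sequentially \<and>
        (\<lambda>k. SUP (t, x) \<in> {(t, x). M k \<le> norm t \<and> M k \<le> norm (t + \<tau> k) \<and> x \<in> B}.
               ennreal (V1 t k) * stepanov_diff (cbox 0 1) p \<phi> c (conv h F) (\<tau> k) t x) \<longlonglongrightarrow> 0"
        by (intro exI[of _ \<tau>] exI[of _ M2] conjI \<tau> M2_pos M2_lim S2_lim[unfolded S_def])
    qed
  qed
qed

end
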